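(* Let $W_1,W_2,\dots$ be i.i.d. $\mathcal{W}$-valued with law $\lambda_0$ and let $\mathcal{N}_n=\widehat{\mathcal{N}}_n(W_1,\dots,W_n)$. Then the sequence of random sets $\{\mathcal{N}_n\}$ converges almost surely to $\mathcal{M}(\lambda_0)$ in $\mathfrak{C}$ equipped with the upper Vietoris topology.
   Context: Standing assumptions: $\mathcal{X}$ compact metric space, $\mathcal{W}$ complete separable metric space; $\mathcal{P}(S)$ = Borel probability measures on $S$ with the weak topology. $\mathcal{C}$ maps $w$ to a nonempty closed $\mathcal{C}(w)\subset\mathcal{X}$, continuous in the sense that $\mathrm{Gr}(\mathcal{C})=\{(w,x):x\in\mathcal{C}(w)\}$ is closed and whenever $w_n\to w$, $x\in\mathcal{C}(w)$ there exist $n_k$, $x_{n_k}\in\mathcal{C}(w_{n_k})$ with $x_{n_k}\to x$. $F:\mathcal{P}(\mathcal{W}\times\mathcal{X})\times\mathcal{W}\times\mathcal{X}\to\mathbb{R}$ bounded continuous. A Nash equilibrium with type vector $(w_1,\dots,w_n)$ is $(x_1,\dots,x_n)$ with $x_i\in\mathcal{C}(w_i)$ and $F(\frac1n\sum_k\delta_{(w_k,x_k)},w_i,x_i)=\inf_{y\in\mathcal{C}(w_i)}F(\frac1n\sum_{k\ne i}\delta_{(w_k,x_k)}+\frac1n\delta_{(w_i,y)},w_i,y)$ for all $i$; such equilibria are assumed to exist for all $n$ and type vectors. $\widehat{\mathcal{N}}_n(w_1,\dots,w_n)$ is the set of $\frac1n\sum_i\delta_{(w_i,x_i)}$ over all Nash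 equilibria $(x_1,\dots,x_n)$ with type vector $(w_1,\dots,w_n)$ (a closed subset of $\mathcal{P}(\mathcal{W}\times\mathcal{X})$). $\mathcal{M}(\lambda)$ is the (closed) set of $m\in\mathcal{P}(\mathcal{W}\times\mathcal{X})$ with first marginal $\lambda$ such that for $m$-a.e. $(w,x)$, $x\in\mathcal{C}(w)$ and $F(m,w,x)=\inf_{y\in\mathcal{C}(w)}F(m,w,y)$. $\mathfrak{C}$ is the set of closed subsets of $\mathcal{P}(\mathcal{W}\times\mathcal{X})$; the upper Vietoris topology on $\mathfrak{C}$ is generated by the base of sets $\{A\in\mathfrak{C}:A\subset E\}$, $E\subset\mathcal{P}(\mathcal{W}\times\mathcal{X})$ open. *)

theory Defs
  imports "HOL-Probability.Probability"
begin

definition prob_measures :: "'a::topological_space measure set" where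
  "prob_measures = {m. prob_space m \<and> sets m = sets borel}"

definition weak_topology :: "'a::topological_space measure topology" where
  "weak_topology = topology_generated_by
     {{m \<in> prob_measures. integral\<^sup>L m (f :: 'a \<Rightarrow> real) \<in> U} | f U.
        continuous_on UNIV f \<and> bounded (range f) \<and> open U}"

definition upper_vietoris :: "'a topology \<Rightarrow> 'a set topology" where
  "upper_vietoris T = topology_generated_by
     {{A. closedin T A \<and> A \<subseteq> E} | E. openin T E}"

definition empirical :: "nat \<Rightarrow> (nat \<Rightarrow> 'a::topological_space) \<Rightarrow> 'a measure" where
  "empirical n z = measure_of UNIV (sets borel)
     (\<lambda>A. (\<Sum>k<n. emeasure (return borel (z k)) A) / of_nat n)"

definition nash ::
  "('w::topological_space \<Rightarrow> 'x::topological_space set) \<Rightarrow> (('w \<times> 'x) measure \<Rightarrow> 'w \<Rightarrow> 'x \<Rightarrow> real)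
   \<Rightarrow> nat \<Rightarrow> (nat \<Rightarrow> 'w) \<Rightarrow> (nat \<Rightarrow> 'x) \<Rightarrow> bool" where
  "nash C F n ws xs \<longleftrightarrow> (\<forall>i<n. xs i \<in> C (ws i) \<and>
     F (empirical n (\<lambda>k. (ws k, xs k))) (ws i) (xs i) =
       (INF y\<in>C (ws i). F (empirical n (\<lambda>k. (ws k, (xs(i := y)) k))) (ws i) y))"

definition nash_set ::
  "('w::topological_space \<Rightarrow> 'x::topological_space set) \<Rightarrow> (('w \<times> 'x) measure \<Rightarrow> 'w \<Rightarrow> 'x \<Rightarrow> real)
   \<Rightarrow> nat \<Rightarrow> (nat \<Rightarrow> 'w) \<Rightarrow> ('w \<times> 'x) measure set" where
  "nash_set C F n ws = {empirical n (\<lambda>k. (ws k, xs k)) | xs. nash C F n ws xs}"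

definition mfe_set ::
  "('w::topological_space \<Rightarrow> 'x::topological_space set) \<Rightarrow> (('w \<times> 'x) measure \<Rightarrow> 'w \<Rightarrow> 'x \<Rightarrow> real)
   \<Rightarrow> 'w measure \<Rightarrow> ('w \<times> 'x) measure set" where
  "mfe_set C F lam = {m \<in> prob_measures. distr m borel fst = lam \<and>
     (AE z in m. snd z \<in> C (fst z) \<and>
        F m (fst z) (snd z) = (INF y\<in>C (fst z). F m (fst z) y))}"

end

theory Submission
  imports Defs
begin

text \<open>
  Almost surely the empirical measures of the types satisfy the law of large numbers for countably
  many bounded functions: bumps that determine a Borel measure on the type space, and indicators of
  complements of compact sets of almost full mass. Fix such a realization and suppose that, for
  infinitely many \<open>n\<close>, some equilibrium measure lies outside a given open neighbourhood of the set of
  limit equilibria. Since the action space is compact these measures are tight, so they have a weak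
  cluster point \<open>m\<close>, whose first marginal is the law of the types.

  A point of the support of \<open>m\<close> that is not a best response for \<open>m\<close> admits a profitable deviation;
  by continuity of the payoff and lower hemicontinuity of the constraint, the deviation stays
  available and profitable, uniformly, on a neighbourhood that the \<open>n\<close>-player equilibria charge.
  Moving one of \<open>n\<close> players does not affect weak limits, so this contradicts the equilibrium
  property. Hence \<open>m\<close> is a limit equilibrium, which contradicts the choice of the measures.

  Cluster points and closures are taken along filters, so the weak topology need not be metrized.
\<close>

subsection \<open>Bounded continuous functions and the weak topology\<close>

text \<open>Upper Vietoris convergence involves uncountably many open sets \<open>E\<close>, so the
  null set must be fixed before \<open>E\<close> is chosen. The probability therefore ends with
  countably many limits of averages, and everything else concerns one fixed sequence of types.
  Tightness is read off from the indicators directly instead of being derived from weak convergence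
  of the type distributions. Since the type space need not be locally compact, a cluster point first
  exists only as a positive linear functional, supplied by Tychonoff's theorem; tightness is what
  turns it into a countably additive measure. Optimality is not passed to the limit as an equation
  between infima. It is refuted locally, one deviation at a time, and a countable basis gathers the
  exceptional points into a null set. The points of the hyperspace are closed sets, so closedness of
  the equilibrium sets has to be proved too; for the limit set this is the same limiting argument,
  with deviations that leave the measure unchanged.\<close>

definition bcf :: "('a::topological_space \<Rightarrow> real) set" where
  "bcf = {f. continuous_on UNIV f \<and> bounded (range f)}"

lemma bcfI:
  assumes "continuous_on UNIV f" "\<And>x. \<bar>f x\<bar> \<le> B"
  shows "f \<in> bcf"
  using assms by (auto simp: bcf_def bounded_iff)

lemma bcf_bound: "f \<in> bcf \<Longrightarrow> \<exists>B\<ge>0. \<forall>x. \<bar>f x\<bar> \<le> B"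
  unfolding bcf_def bounded_pos by (auto intro: less_imp_le)

lemma bcf_comp:
  assumes "f \<in> bcf" "continuous_on UNIV g"
  shows "(\<lambda>x. f (g x)) \<in> bcf"
  using assms continuous_on_compose2[of UNIV f UNIV g] by (auto simp: bcf_def bounded_iff)

lemma bcf_const: "(\<lambda>_. c) \<in> bcf"
  by (rule bcfI[where B="\<bar>c\<bar>"]) auto

lemma bcf_add:
  assumes "f \<in> bcf" "g \<in> bcf" shows "(\<lambda>x. f x + g x) \<in> bcf"
proof -
  obtain A B where "\<And>x. \<bar>f x\<bar> \<le> A" "\<And>x. \<bar>g x\<bar> \<le> B"
    using bcf_bound assms by metis
  then show ?thesis
    by (intro bcfI[where B="A + B"] continuous_intros order_trans[OF abs_triangle_ineq add_mono])
       (use assms in \<open>auto simp: bcf_def\<close>)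
qed

lemma bcf_mult:
  assumes "f \<in> bcf" "g \<in> bcf" shows "(\<lambda>x. f x * g x) \<in> bcf"
proof -
  obtain A B where AB: "A \<ge> 0" "\<And>x. \<bar>f x\<bar> \<le> A" "\<And>x. \<bar>g x\<bar> \<le> B"
    using bcf_bound assms by metis
  then show ?thesis
    by (intro bcfI[where B="A * B"] continuous_intros)
       (use assms in \<open>auto simp: bcf_def abs_mult intro!: mult_mono\<close>)
qed

lemma bcf_cmult: "f \<in> bcf \<Longrightarrow> (\<lambda>x. c * f x) \<in> bcf"
  by (intro bcf_mult bcf_const)

lemma bcf_diff: "f \<in> bcf \<Longrightarrow> g \<in> bcf \<Longrightarrow> (\<lambda>x. f x - g x) \<in> bcf"
  using bcf_add[OF _ bcf_cmult[of g "-1"], of f] by simp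

lemma bcf_max:
  assumes "f \<in> bcf" "g \<in> bcf" shows "(\<lambda>x. max (f x) (g x)) \<in> bcf"
proof -
  obtain A B where AB: "A \<ge> 0" "B \<ge> 0" "\<And>x. \<bar>f x\<bar> \<le> A" "\<And>x. \<bar>g x\<bar> \<le> B"
    using bcf_bound assms by metis
  have "\<bar>max (f x) (g x)\<bar> \<le> A + B" for x
    using AB(1,2) AB(3)[of x] AB(4)[of x] by linarith
  moreover have "continuous_on UNIV (\<lambda>x. max (f x) (g x))"
    using assms by (intro continuous_on_max) (auto simp: bcf_def)
  ultimately show ?thesis by (rule bcfI[rotated])
qed

lemma bcf_min:
  assumes "f \<in> bcf" "g \<in> bcf" shows "(\<lambda>x. min (f x) (g x)) \<in> bcf"
proof -
  have "(\<lambda>x. f x + g x - max (f x) (g x)) \<in> bcf"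
    by (intro bcf_diff bcf_add bcf_max assms)
  moreover have "(\<lambda>x. f x + g x - max (f x) (g x)) = (\<lambda>x. min (f x) (g x))"
    by (auto simp: fun_eq_iff)
  ultimately show ?thesis by simp
qed

lemma bcf_sum: "(\<And>i. i \<in> I \<Longrightarrow> f i \<in> bcf) \<Longrightarrow> (\<lambda>x. \<Sum>i\<in>I. f i x) \<in> bcf"
  by (induction I rule: infinite_finite_induct) (auto intro: bcf_const bcf_add)

section \<open>Integrals of bounded continuous functions\<close>

lemma prob_measuresD:
  assumes "m \<in> prob_measures"
  shows "prob_space m" "sets m = sets borel" "space m = UNIV"
proof -
  have *: "prob_space m \<and> sets m = sets borel"
    using assms unfolding prob_measures_def by (rule CollectD)
  then show "prob_space m" "sets m = sets borel" by blast+
  show "space m = UNIV"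
    using sets_eq_imp_space_eq[OF conjunct2[OF *]] unfolding space_borel .
qed

lemma measurable_bcf:
  assumes "f \<in> bcf" "sets m = sets borel"
  shows "f \<in> borel_measurable m"
  unfolding measurable_cong_sets[OF assms(2) refl]
  using assms(1) by (intro borel_measurable_continuous_onI) (simp add: bcf_def)

lemma integrable_bcf:
  assumes "m \<in> prob_measures" "f \<in> bcf"
  shows "integrable m f"
proof -
  interpret prob_space m using prob_measuresD[OF assms(1)] by simp
  obtain B where "\<And>x. \<bar>f x\<bar> \<le> B" using bcf_bound[OF assms(2)] by auto
  then show ?thesis
    by (intro integrable_const_bound[of _ B] measurable_bcf[OF assms(2)])
       (auto simp: prob_measuresD[OF assms(1)])
qed

lemma integral_bcf_bound:
  assumes "m \<in> prob_measures" "f \<in> bcf" "\<And>x. \<bar>f x\<bar> \<le> B"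
  shows "\<bar>integral\<^sup>L m f\<bar> \<le> B"
proof -
  interpret prob_space m using prob_measuresD[OF assms(1)] by simp
  have "f x \<le> B" "- B \<le> f x" for x
    using assms(3)[of x] by linarith+
  then have "integral\<^sup>L m f \<le> integral\<^sup>L m (\<lambda>x. B)"
      "integral\<^sup>L m (\<lambda>x. - B) \<le> integral\<^sup>L m f"
    by (intro integral_mono integrable_bcf[OF assms(1,2)] integrable_const; simp)+
  then show ?thesis by (simp add: prob_space)
qed

text \<open>The open sets that satisfy the implication are closed under finite intersections and
  arbitrary unions, so a subbase suffices. The condition \<open>l \<in> \<Union>S\<close> places
  \<open>l\<close> in the topological space. Both the weak and the upper Vietoris topology are
  handled through this characterization.\<close>

lemma limitin_topology_generated_by:
  "limitin (topology_generated_by S) f l F \<longleftrightarrow>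
     l \<in> \<Union>S \<and> (\<forall>U\<in>S. l \<in> U \<longrightarrow> (\<forall>\<^sub>F x in F. f x \<in> U))"
proof (intro iffI conjI)
  assume L: "limitin (topology_generated_by S) f l F"
  show "l \<in> \<Union>S"
    using limitin_topspace[OF L] unfolding topology_generated_by_topspace .
  show "\<forall>U\<in>S. l \<in> U \<longrightarrow> (\<forall>\<^sub>F x in F. f x \<in> U)"
    by (intro ballI impI limitinD[OF L] topology_generated_by_Basis)
next
  assume R: "l \<in> \<Union>S \<and> (\<forall>U\<in>S. l \<in> U \<longrightarrow> (\<forall>\<^sub>F x in F. f x \<in> U))"
  have "l \<in> U \<longrightarrow> (\<forall>\<^sub>F x in F. f x \<in> U)" if "generate_topology_on S U" for U
    using that
  proof induction
    case (UN K)
    show ?case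
    proof
      assume "l \<in> \<Union> K"
      then obtain k where k: "k \<in> K" "l \<in> k" by blast
      with UN have "\<forall>\<^sub>F x in F. f x \<in> k" by blast
      then show "\<forall>\<^sub>F x in F. f x \<in> \<Union> K"
        by (rule eventually_mono) (use k in blast)
    qed
  qed (use R in \<open>auto simp: eventually_conj_iff\<close>)
  with R show "limitin (topology_generated_by S) f l F"
    by (auto simp: limitin_def dest: openin_topology_generated_by)
qed

section \<open>Weak convergence along filters\<close>

lemma topspace_weak_topology:
  "topspace weak_topology = (prob_measures :: 'a::topological_space measure set)"
proof -
  have "prob_measures = {m \<in> prob_measures. integral\<^sup>L m (\<lambda>_::'a. 0::real) \<in> UNIV}" by simp
  moreover have "continuous_on UNIV (\<lambda>_::'a. 0::real) \<and> bounded (range (\<lambda>_::'a. 0::real)) \<and>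
      open (UNIV::real set)"
    by simp
  ultimately have "prob_measures \<in> {{m \<in> prob_measures. integral\<^sup>L m (f :: 'a \<Rightarrow> real) \<in> U} | f U.
        continuous_on UNIV f \<and> bounded (range f) \<and> open U}"
    by blast
  then show ?thesis unfolding weak_topology_def topology_generated_by_topspace by blast
qed

lemma limitin_weak_topology:
  fixes m :: "'a::topological_space measure"
  shows
  "limitin weak_topology \<mu> m F \<longleftrightarrow> m \<in> prob_measures \<and> (\<forall>\<^sub>F i in F. \<mu> i \<in> prob_measures) \<and>
     (\<forall>f\<in>bcf. ((\<lambda>i. integral\<^sup>L (\<mu> i) f) \<longlongrightarrow> integral\<^sup>L m f) F)"
proof (intro iffI)
  assume L: "limitin weak_topology \<mu> m F"
  have P: "m \<in> prob_measures"
    using limitin_topspace[OF L] by (simp add: topspace_weak_topology)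
  have "\<forall>\<^sub>F i in F. \<mu> i \<in> topspace weak_topology"
    using L P openin_topspace by (metis limitin_def topspace_weak_topology)
  moreover have "((\<lambda>i. integral\<^sup>L (\<mu> i) f) \<longlongrightarrow> integral\<^sup>L m f) F" if "f \<in> bcf" for f
  proof (rule topological_tendstoI)
    fix S :: "real set" assume "open S" "integral\<^sup>L m f \<in> S"
    then have "openin weak_topology {m \<in> prob_measures. integral\<^sup>L m f \<in> S}"
      unfolding weak_topology_def
      by (intro topology_generated_by_Basis) (use that in \<open>auto simp: bcf_def\<close>)
    then have "\<forall>\<^sub>F i in F. \<mu> i \<in> {m \<in> prob_measures. integral\<^sup>L m f \<in> S}"
      using L P \<open>integral\<^sup>L m f \<in> S\<close> by (auto simp: limitin_def)
    then show "\<forall>\<^sub>F i in F. integral\<^sup>L (\<mu> i) f \<in> S" by (rule eventually_mono) simp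
  qed
  ultimately show "m \<in> prob_measures \<and> (\<forall>\<^sub>F i in F. \<mu> i \<in> prob_measures) \<and>
     (\<forall>f\<in>bcf. ((\<lambda>i. integral\<^sup>L (\<mu> i) f) \<longlongrightarrow> integral\<^sup>L m f) F)"
    using P by (simp add: topspace_weak_topology)
next
  assume R: "m \<in> prob_measures \<and> (\<forall>\<^sub>F i in F. \<mu> i \<in> prob_measures) \<and>
     (\<forall>f\<in>bcf. ((\<lambda>i. integral\<^sup>L (\<mu> i) f) \<longlongrightarrow> integral\<^sup>L m f) F)"
  show "limitin weak_topology \<mu> m F"
    unfolding weak_topology_def limitin_topology_generated_by
  proof (intro conjI ballI impI)
    show "m \<in> \<Union>{{m \<in> prob_measures. integral\<^sup>L m f \<in> U} |(f :: 'a \<Rightarrow> real) U.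
        continuous_on UNIV f \<and> bounded (range f) \<and> open U}"
      using R topspace_weak_topology[unfolded weak_topology_def topology_generated_by_topspace]
      by auto
  next
    fix A :: "'a measure set" assume "A \<in> {{m \<in> prob_measures. integral\<^sup>L m f \<in> U} |(f :: 'a \<Rightarrow> real) U.
        continuous_on UNIV f \<and> bounded (range f) \<and> open U}" and "m \<in> A"
    then obtain f :: "'a \<Rightarrow> real" and U where A: "A = {m \<in> prob_measures. integral\<^sup>L m f \<in> U}" "open U"
        and "continuous_on UNIV f \<and> bounded (range f)" by blast
    then have "f \<in> bcf" "integral\<^sup>L m f \<in> U" using \<open>m \<in> A\<close> by (simp_all add: bcf_def)
    with R A(2) have "\<forall>\<^sub>F i in F. integral\<^sup>L (\<mu> i) f \<in> U" by (auto dest: topological_tendstoD)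
    with R show "\<forall>\<^sub>F i in F. \<mu> i \<in> A" by (simp add: A eventually_conj_iff)
  qed
qed

text \<open>Replaces the sequential criterion. If every neighbourhood of \<open>l\<close> meets
  \<open>A\<close>, then the trace on \<open>A\<close> of the neighbourhood filter of
  \<open>l\<close> is proper, converges to \<open>l\<close> and lives on \<open>A\<close>.\<close>

lemma closedin_limitinI:
  assumes "A \<subseteq> topspace T"
    and "\<And>F l. F \<noteq> bot \<Longrightarrow> limitin T (\<lambda>x. x) l F \<Longrightarrow> (\<forall>\<^sub>F x in F. x \<in> A) \<Longrightarrow> l \<in> A"
  shows "closedin T A"
proof -
  have "\<exists>U. openin T U \<and> l \<in> U \<and> U \<subseteq> topspace T - A" if l: "l \<in> topspace T - A" for l
  proof (rule ccontr)
    assume N: "\<not> ?thesis"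
    let ?F = "inf (nhdsin T l) (principal A)"
    have "?F \<noteq> bot"
    proof
      assume "?F = bot"
      then have "eventually (\<lambda>x. x \<in> A \<longrightarrow> False) (nhdsin T l)"
        using eventually_inf_principal[of "\<lambda>_. False" "nhdsin T l" A] by simp
      then obtain U where "openin T U" "l \<in> U" "\<forall>x\<in>U. x \<notin> A"
        using l by (auto simp: eventually_nhdsin)
      with N show False using openin_subset[of T U] by blast
    qed
    moreover have "limitin T (\<lambda>x. x) l ?F"
      using l by (auto simp: limitin_def eventually_inf_principal eventually_nhdsin)
    moreover have "\<forall>\<^sub>F x in ?F. x \<in> A" by (simp add: eventually_inf_principal)
    ultimately show False using assms(2) l by blast
  qed
  then have "openin T (topspace T - A)" by (subst openin_subopen) blast
  with assms(1) show ?thesis by (simp add: closedin_def)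
qed

text \<open>The case distinction is needed because the distance to the empty set is \<open>0\<close>.\<close>

definition gap :: "'a::metric_space set \<Rightarrow> 'a \<Rightarrow> real" where
  "gap U x = (if U = UNIV then 1 else infdist x (- U))"

text \<open>For open \<open>U\<close> these functions increase with \<open>k\<close> to the
  indicator of \<open>U\<close>. The natural number index keeps the family countable, so an almost
  sure statement can treat all \<open>k\<close> at once.\<close>

definition bump :: "'a::metric_space set \<Rightarrow> nat \<Rightarrow> 'a \<Rightarrow> real" where
  "bump U k x = min 1 (real k * gap U x)"

lemma continuous_on_gap: "continuous_on A (gap U)"
proof (cases "U = UNIV")
  case False
  then show ?thesis unfolding gap_def by (simp add: continuous_on_infdist continuous_on_id)
qed (simp add: gap_def continuous_on_const)

lemma gap_nonneg: "0 \<le> gap U x"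
  by (simp add: gap_def infdist_nonneg)

lemma gap_pos:
  assumes "open U" "x \<in> U"
  shows "0 < gap U x"
proof (cases "U = UNIV")
  case False
  then have "- U \<noteq> {}" by auto
  with in_closed_iff_infdist_zero[of "- U" x] assms gap_nonneg[of U x] False
  show ?thesis by (auto simp: gap_def less_le)
qed (simp add: gap_def)

lemma gap_outside: "x \<notin> U \<Longrightarrow> gap U x = 0"
  by (auto simp: gap_def)

lemma bump_bounds: "0 \<le> bump U k x" "bump U k x \<le> 1" "bump U k x \<le> indicator U x"
  by (auto simp: bump_def gap_nonneg gap_outside indicator_def)

lemma bump_mono: "k \<le> l \<Longrightarrow> bump U k x \<le> bump U l x"
  unfolding bump_def by (intro min.mono mult_right_mono gap_nonneg) auto

lemma bump_bcf: "bump U k \<in> bcf"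
proof (rule bcfI[where B=1])
  show "continuous_on UNIV (bump U k)"
    unfolding bump_def by (intro continuous_intros continuous_on_gap)
  show "\<bar>bump U k x\<bar> \<le> 1" for x
    using bump_bounds(1,2)[of U k x] by simp
qed

lemma eventually_bump_eq_1:
  assumes "open U" "x \<in> U"
  shows "\<forall>\<^sub>F k in sequentially. bump U k x = 1"
proof -
  obtain N :: nat where N: "1 \<le> real N * gap U x"
    using reals_Archimedean3[OF gap_pos[OF assms]] less_imp_le by blast
  have "bump U k x = 1" if "k \<ge> N" for k
    using mult_right_mono[of "real N" "real k" "gap U x"] N that gap_nonneg[of U x]
    by (simp add: bump_def)
  then show ?thesis by (auto intro!: eventually_sequentiallyI[of N])
qed

lemma bump_tendsto:
  assumes "open U"
  shows "(\<lambda>k. bump U k x) \<longlonglongrightarrow> indicator U x"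
proof (cases "x \<in> U")
  case True
  then show ?thesis
    using eventually_bump_eq_1[OF assms True] by (simp add: tendsto_eventually)
qed (simp add: bump_def gap_outside)

section \<open>Measures determined by their integrals\<close>

lemma integral_bump_tendsto:
  assumes "m \<in> prob_measures" "open U"
  shows "(\<lambda>k. integral\<^sup>L m (bump U k)) \<longlonglongrightarrow> measure m U"
proof -
  interpret prob_space m using prob_measuresD[OF assms(1)] by simp
  have U: "U \<in> sets m" using assms by (simp add: prob_measuresD)
  have "(\<lambda>k. integral\<^sup>L m (bump U k)) \<longlonglongrightarrow> integral\<^sup>L m (indicator U)"
  proof (rule integral_dominated_convergence[where w="\<lambda>_. 1"])
    show "AE x in m. norm (bump U k x) \<le> 1" for k
      by (intro AE_I2) (simp add: bump_bounds(1,2))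
  qed (use U measurable_bcf[OF bump_bcf prob_measuresD(2)[OF assms(1)]] in
        \<open>simp_all add: bump_tendsto[OF assms(2)]\<close>)
  also have "integral\<^sup>L m (indicator U) = measure m U"
    using U by simp
  finally show ?thesis .
qed

text \<open>Bumps recover the measures of the open sets in a generating pi-system, and these
  determine the measure. With a countable system only countably many integrals have to be compared,
  which is all that an almost sure limit theorem can deliver.\<close>

lemma prob_measures_eqI_generator:
  assumes m: "m \<in> prob_measures" "m' \<in> prob_measures"
    and B: "Int_stable B" "sets borel = sigma_sets UNIV B" "\<And>U. U \<in> B \<Longrightarrow> open U"
    and eq: "\<And>U k. U \<in> B \<Longrightarrow> integral\<^sup>L m (bump U k) = integral\<^sup>L m' (bump U k)"
  shows "m = m'"
proof (rule measure_eqI_generator_eq_countable[where A="{UNIV}" and E="insert UNIV B" and \<Omega>=UNIV])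
  interpret m: prob_space m using prob_measuresD[OF m(1)] by simp
  interpret m': prob_space m' using prob_measuresD[OF m(2)] by simp
  \<comment> \<open>\<open>UNIV\<close> is adjoined because the uniqueness theorem wants the space
    covered by generators of finite measure, and it may be missing from \<open>B\<close>.\<close>
  have s: "sigma_sets UNIV (insert UNIV B) = sigma_sets UNIV B"
    by (intro sigma_sets_eqI) (auto intro: sigma_sets.Basic sigma_sets_top)
  show "sets m = sigma_sets UNIV (insert UNIV B)" "sets m' = sigma_sets UNIV (insert UNIV B)"
    using m B(2) by (simp_all add: prob_measuresD s)
  show "Int_stable (insert UNIV B)" using B(1) by (auto simp: Int_stable_def)
  fix X assume X: "X \<in> insert UNIV B"
  have "measure m X = measure m' X"
  proof (cases "X = UNIV")
    case True
    then show ?thesis using m.prob_space m'.prob_space m by (simp add: prob_measuresD)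
  next
    case False
    then have "X \<in> B" using X by simp
    with integral_bump_tendsto[OF m(1), of X] integral_bump_tendsto[OF m(2), of X] B(3) eq
    show ?thesis by (simp add: LIMSEQ_unique)
  qed
  then show "emeasure m X = emeasure m' X"
    by (simp add: m.emeasure_eq_measure m'.emeasure_eq_measure)
qed (use prob_space.emeasure_space_1 prob_measuresD[OF m(1)] in \<open>force+\<close>)

lemma prob_measures_eqI:
  fixes m m' :: "'a::metric_space measure"
  assumes m: "m \<in> prob_measures" "m' \<in> prob_measures"
    and eq: "\<And>f. f \<in> bcf \<Longrightarrow> integral\<^sup>L m f = integral\<^sup>L m' f"
  shows "m = m'"
proof (rule prob_measures_eqI_generator[OF m, of "{U. open U}"])
  show "sets borel = sigma_sets UNIV {U::'a set. open U}"
    by (simp add: borel_def)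
qed (auto simp: Int_stable_def intro: eq bump_bcf)

lemma Hausdorff_weak_topology: "Hausdorff_space (weak_topology :: 'a::metric_space measure topology)"
  unfolding Hausdorff_space_def topspace_weak_topology
proof (intro allI impI)
  fix m m' :: "'a measure"
  assume A: "m \<in> prob_measures \<and> m' \<in> prob_measures \<and> m \<noteq> m'"
  then obtain f where f: "f \<in> bcf" "integral\<^sup>L m f \<noteq> integral\<^sup>L m' f"
    using prob_measures_eqI by blast
  then obtain U V where UV: "open U" "open V" "integral\<^sup>L m f \<in> U" "integral\<^sup>L m' f \<in> V" "U \<inter> V = {}"
    using separation_t2[of "integral\<^sup>L m f" "integral\<^sup>L m' f"] by auto
  have op: "openin weak_topology {m \<in> prob_measures. integral\<^sup>L m f \<in> S}" if "open S" for S
    unfolding weak_topology_def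
    by (intro topology_generated_by_Basis) (use that f in \<open>auto simp: bcf_def\<close>)
  show "\<exists>U V. openin weak_topology U \<and> openin weak_topology V \<and> m \<in> U \<and> m' \<in> V \<and> disjnt U V"
  proof (intro exI conjI)
    show "openin weak_topology {m \<in> prob_measures. integral\<^sup>L m f \<in> U}"
         "openin weak_topology {m \<in> prob_measures. integral\<^sup>L m f \<in> V}"
      using op UV(1,2) by blast+
    show "disjnt {m \<in> prob_measures. integral\<^sup>L m f \<in> U} {m \<in> prob_measures. integral\<^sup>L m f \<in> V}"
      using UV(5) unfolding disjnt_def by blast
  qed (use A UV(3,4) in blast)+
qed

text \<open>The qualitative half of the portmanteau theorem. Some bump below the indicator of
  \<open>U\<close> already has positive integral under \<open>m\<close>, and that positivity
  survives weak convergence.\<close>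

lemma eventually_open_set_pos:
  fixes m :: "'a::metric_space measure"
  assumes L: "limitin weak_topology \<mu> m F" and U: "open U" "measure m U > 0"
  shows "\<forall>\<^sub>F i in F. measure (\<mu> i) U > 0"
proof -
  have "m \<in> prob_measures" using L by (simp add: limitin_weak_topology)
  from order_tendstoD(1)[OF integral_bump_tendsto[OF this U(1)] U(2)]
  obtain k where "integral\<^sup>L m (bump U k) > 0"
    by (auto simp: eventually_sequentially)
  then have "\<forall>\<^sub>F i in F. integral\<^sup>L (\<mu> i) (bump U k) > 0"
    using L order_tendstoD(1) bump_bcf by (fastforce simp: limitin_weak_topology)
  moreover have "\<forall>\<^sub>F i in F. \<mu> i \<in> prob_measures" using L by (simp add: limitin_weak_topology)
  ultimately show ?thesis
  proof eventually_elim
    case (elim i)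
    interpret prob_space "\<mu> i" using prob_measuresD[OF elim(2)] by simp
    have "U \<in> sets (\<mu> i)" using elim(2) U by (simp add: prob_measuresD)
    then have "integral\<^sup>L (\<mu> i) (bump U k) \<le> integral\<^sup>L (\<mu> i) (indicator U)"
      by (intro integral_mono integrable_bcf[OF elim(2) bump_bcf] bump_bounds) (auto simp: emeasure_eq_measure)
    with elim(1) \<open>U \<in> sets (\<mu> i)\<close> show ?case by simp
  qed
qed

subsection \<open>Representation of functionals by measures\<close>

text \<open>
  Riesz representation without local compactness: continuity of the functional along decreasing
  sequences of functions replaces compact supports, and it holds for limits of tight families by
  Dini's theorem.
\<close>

locale smooth_functional =
  fixes L :: "('a::metric_space \<Rightarrow> real) \<Rightarrow> real"
  assumes add: "f \<in> bcf \<Longrightarrow> g \<in> bcf \<Longrightarrow> L (\<lambda>x. f x + g x) = L f + L g"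
    and scale: "f \<in> bcf \<Longrightarrow> L (\<lambda>x. c * f x) = c * L f"
    and mono: "f \<in> bcf \<Longrightarrow> g \<in> bcf \<Longrightarrow> (\<And>x. f x \<le> g x) \<Longrightarrow> L f \<le> L g"
    and one: "L (\<lambda>_. 1) = 1"
    and smooth: "(\<And>n. r n \<in> bcf) \<Longrightarrow> (\<And>n x. r (Suc n) x \<le> r n x) \<Longrightarrow>
      (\<And>x. (\<lambda>n. r n x) \<longlonglongrightarrow> 0) \<Longrightarrow> (\<lambda>n::nat. L (r n)) \<longlonglongrightarrow> 0"
begin

lemma const: "L (\<lambda>_. c) = c"
  using scale[OF bcf_const, of c 1] one by simp

lemma nonneg: "f \<in> bcf \<Longrightarrow> (\<And>x. 0 \<le> f x) \<Longrightarrow> 0 \<le> L f"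
  using mono[OF bcf_const, of f 0] const by simp

lemma sum: "(\<And>i. i \<in> I \<Longrightarrow> f i \<in> bcf) \<Longrightarrow> L (\<lambda>x. \<Sum>i\<in>I. f i x) = (\<Sum>i\<in>I. L (f i))"
  by (induction I rule: infinite_finite_induct) (auto simp: const add bcf_sum)

definition below :: "'a set \<Rightarrow> ('a \<Rightarrow> real) set" where
  "below U = {f \<in> bcf. \<forall>x. 0 \<le> f x \<and> f x \<le> indicator U x}"

text \<open>The value that a representing measure must give to an open set. The competitors in
  \<open>below U\<close> are only bounded by the indicator and may have noncompact support.\<close>

definition nu :: "'a set \<Rightarrow> ennreal" where
  "nu U = (SUP f\<in>below U. ennreal (L f))"

definition outer :: "'a set \<Rightarrow> ennreal" where
  "outer A = (INF U\<in>{U. open U \<and> A \<subseteq> U}. nu U)"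

lemma zero_below: "(\<lambda>_. 0) \<in> below U"
  by (simp add: below_def bcf_const)

lemma below_nonneg: "f \<in> below U \<Longrightarrow> 0 \<le> L f"
  by (auto simp: below_def intro: nonneg)

lemma nu_upper: "f \<in> below U \<Longrightarrow> ennreal (L f) \<le> nu U"
  unfolding nu_def by (rule SUP_upper)

lemma nu_mono:
  assumes "U \<subseteq> V" shows "nu U \<le> nu V"
proof -
  have "below U \<subseteq> below V"
  proof
    fix f assume "f \<in> below U"
    moreover have "indicator U x \<le> (indicator V x :: real)" for x
      using assms by (auto simp: indicator_def)
    ultimately show "f \<in> below V" unfolding below_def using order_trans by blast
  qed
  then show ?thesis unfolding nu_def by (rule SUP_subset_mono) simp
qed

lemma nu_empty: "nu {} = 0"
proof -
  have "L f = 0" if "f \<in> below {}" for f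
  proof -
    have "f = (\<lambda>_. 0)" using that by (auto simp: below_def fun_eq_iff intro: antisym)
    then show ?thesis using const by simp
  qed
  then have "nu {} \<le> 0" unfolding nu_def by (intro SUP_least) simp
  then show ?thesis by simp
qed

lemma nu_UNIV: "nu UNIV = 1"
proof (rule antisym)
  show "nu UNIV \<le> 1" unfolding nu_def
  proof (rule SUP_least)
    fix f :: "'a \<Rightarrow> real" assume "f \<in> below UNIV"
    then have "L f \<le> L (\<lambda>_. 1)" by (intro mono bcf_const) (auto simp: below_def)
    then show "ennreal (L f) \<le> 1" by (simp add: one)
  qed
  have "(\<lambda>_. 1) \<in> below UNIV" by (simp add: below_def bcf_const)
  from nu_upper[OF this] show "1 \<le> nu UNIV" by (simp add: one)
qed

text \<open>The step at which \<open>smooth\<close> is used, where the locally compact theory would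
  cover a compact support by finitely many sets. A function below the union is split into pieces
  below single sets and a remainder that decreases to zero pointwise.\<close>

lemma nu_UN:
  fixes U :: "nat \<Rightarrow> 'a set"
  assumes U: "\<And>i. open (U i)"
  shows "nu (\<Union>i. U i) \<le> (\<Sum>i. nu (U i))"
  unfolding nu_def[of "\<Union>i. U i"]
proof (rule SUP_least)
  fix f assume f: "f \<in> below (\<Union>i. U i)"
  then have fb: "f \<in> bcf" and f0: "\<And>x. 0 \<le> f x" and f1: "\<And>x. f x \<le> indicator (\<Union>i. U i) x"
    by (auto simp: below_def)
  \<comment> \<open>The index \<open>n\<close> counts the sets used and is also the level of the
    bumps. A point of some \<open>U i\<close> has bump value exactly 1 from some level on, so its
    remainder \<open>r n x\<close> eventually vanishes.\<close>
  define h where "h n i x = f x * bump (U i) n x" for n i x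
  define r where "r n x = f x * max 0 (1 - (\<Sum>i<n. bump (U i) n x))" for n x
  have hb: "h n i \<in> bcf" for n i
    unfolding h_def by (intro bcf_mult fb bump_bcf)
  have rb: "r n \<in> bcf" for n
    unfolding r_def by (intro bcf_mult fb bcf_max bcf_diff bcf_sum bcf_const bump_bcf)
  have h_below: "h n i \<in> below (U i)" for n i
  proof -
    have "f x \<le> 1" for x using f1[of x] indicator_le_1[of "\<Union>i. U i" x] order_trans by blast
    then have "h n i x \<le> 1 * indicator (U i) x" for x
      unfolding h_def by (intro mult_mono bump_bounds f0) auto
    then show ?thesis
      using hb f0 bump_bounds(1)[of "U i" n] by (auto simp: below_def h_def)
  qed
  have "(\<lambda>n. L (r n)) \<longlonglongrightarrow> 0"
  proof (rule smooth[OF rb])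
    fix n x
    have "(\<Sum>i<n. bump (U i) n x) \<le> (\<Sum>i<n. bump (U i) (Suc n) x)"
      by (intro sum_mono bump_mono) simp
    also have "\<dots> \<le> (\<Sum>i<Suc n. bump (U i) (Suc n) x)"
      by (simp add: bump_bounds)
    finally show "r (Suc n) x \<le> r n x"
      unfolding r_def by (intro mult_left_mono f0 max.mono) auto
  next
    fix x
    show "(\<lambda>n. r n x) \<longlonglongrightarrow> 0"
    proof (cases "x \<in> (\<Union>i. U i)")
      case True
      then obtain i where i: "x \<in> U i" by blast
      have "\<forall>\<^sub>F n in sequentially. r n x = 0"
        using eventually_bump_eq_1[OF U i] eventually_gt_at_top[of i]
      proof eventually_elim
        case (elim n)
        have "bump (U i) n x \<le> (\<Sum>i<n. bump (U i) n x)"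
          using elim(2) by (intro member_le_sum) (auto simp: bump_bounds)
        with elim(1) show ?case by (simp add: r_def)
      qed
      then show ?thesis by (rule tendsto_eventually)
    next
      case False
      then have "f x = 0" using f0[of x] f1[of x] by (auto simp: antisym)
      then show ?thesis by (simp add: r_def)
    qed
  qed
  then have lim: "(\<lambda>n. ennreal (L (r n)) + (\<Sum>i. nu (U i))) \<longlonglongrightarrow> ennreal 0 + (\<Sum>i. nu (U i))"
    by (intro tendsto_intros tendsto_ennrealI)
  have "ennreal (L f) \<le> ennreal (L (r n)) + (\<Sum>i. nu (U i))" for n
  proof -
    have r0: "0 \<le> L (r n)" by (intro nonneg rb) (simp add: r_def f0)
    have "f x \<le> r n x + (\<Sum>i<n. h n i x)" for x
    proof -
      let ?s = "\<Sum>i<n. bump (U i) n x"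
      have "f x * 1 \<le> f x * (max 0 (1 - ?s) + ?s)"
        by (intro mult_left_mono f0) auto
      then show ?thesis by (simp add: r_def h_def distrib_left sum_distrib_left)
    qed
    then have "L f \<le> L (\<lambda>x. r n x + (\<Sum>i<n. h n i x))"
      by (intro mono fb bcf_add rb bcf_sum hb)
    also have "\<dots> = L (r n) + (\<Sum>i<n. L (h n i))"
      by (simp add: add sum bcf_sum rb hb)
    finally have "ennreal (L f) \<le> ennreal (L (r n) + (\<Sum>i<n. L (h n i)))"
      by (rule ennreal_leI)
    also have "\<dots> = ennreal (L (r n)) + (\<Sum>i<n. ennreal (L (h n i)))"
      using r0 below_nonneg[OF h_below] by (simp add: ennreal_plus sum_nonneg sum_ennreal)
    also have "(\<Sum>i<n. ennreal (L (h n i))) \<le> (\<Sum>i<n. nu (U i))"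
      by (intro sum_mono nu_upper h_below)
    also have "\<dots> \<le> (\<Sum>i. nu (U i))"
      by (intro sum_le_suminf) auto
    finally show ?thesis by (simp add: add_left_mono)
  qed
  then have "ennreal (L f) \<le> ennreal 0 + (\<Sum>i. nu (U i))"
    by (intro tendsto_lowerbound[OF lim]) auto
  then show "ennreal (L f) \<le> (\<Sum>i. nu (U i))" by simp
qed

section \<open>The outer measure and its measurable sets\<close>

lemma outer_open: "open U \<Longrightarrow> outer U = nu U"
  unfolding outer_def by (intro antisym INF_lower INF_greatest nu_mono) auto

lemma outer_mono: "A \<subseteq> B \<Longrightarrow> outer A \<le> outer B"
  unfolding outer_def by (intro INF_superset_mono) auto

lemma outer_UN: "outer (\<Union>i::nat. A i) \<le> (\<Sum>i. outer (A i))"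
proof (rule ennreal_le_epsilon)
  fix e :: real assume e: "0 < e" and fin: "(\<Sum>i. outer (A i)) < top"
  have "\<exists>U. open U \<and> A n \<subseteq> U \<and> nu U \<le> outer (A n) + e * (1/2)^Suc n" for n
  proof -
    have "outer (A n) < top" using fin by (auto simp: less_top dest!: ennreal_suminf_lessD)
    then have "outer (A n) < outer (A n) + e * (1/2)^Suc n"
      using e by (auto simp: less_top)
    then show ?thesis
      unfolding outer_def[of "A n"] INF_less_iff by (auto intro: less_imp_le)
  qed
  then obtain U where U: "\<And>n. open (U n)" "\<And>n. A n \<subseteq> U n"
      "\<And>n. nu (U n) \<le> outer (A n) + e * (1/2)^Suc n" by metis
  have "outer (\<Union>i. A i) \<le> outer (\<Union>i. U i)"
    by (rule outer_mono) (use U(2) in blast)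
  also have "\<dots> = nu (\<Union>i. U i)" using U(1) by (simp add: outer_open open_UN)
  also have "\<dots> \<le> (\<Sum>i. nu (U i))" by (rule nu_UN[OF U(1)])
  also have "\<dots> \<le> (\<Sum>n. outer (A n) + e * (1/2) ^ Suc n)"
    by (intro suminf_le U(3)) auto
  also have "\<dots> = (\<Sum>n. outer (A n)) + (\<Sum>n. ennreal e * ennreal ((1/2) ^ Suc n))"
    using e by (subst suminf_add[symmetric])
       (auto simp del: ennreal_suminf_cmult simp add: ennreal_mult[symmetric])
  also have "\<dots> = (\<Sum>n. outer (A n)) + e"
    unfolding ennreal_suminf_cmult
    by (subst suminf_ennreal_eq[OF zero_le_power power_half_series]) auto
  finally show "outer (\<Union>i. A i) \<le> (\<Sum>i. outer (A i)) + e" .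
qed

lemma outer_empty: "outer {} = 0"
  using outer_open[of "{}"] nu_empty by simp

lemma outer_Un: "outer (A \<union> B) \<le> outer A + outer B"
proof -
  have "outer (\<Union>i::nat. if i = 0 then A else if i = 1 then B else {}) \<le>
      (\<Sum>i::nat. outer (if i = 0 then A else if i = 1 then B else {}))" by (rule outer_UN)
  also have "(\<Sum>i::nat. outer (if i = 0 then A else if i = 1 then B else {})) =
      (\<Sum>i\<in>{0,1::nat}. outer (if i = 0 then A else if i = 1 then B else {}))"
    by (intro suminf_finite) (auto simp: outer_empty)
  also have "(\<Union>i::nat. if i = 0 then A else if i = 1 then B else {}) = A \<union> B"
    by (auto split: if_splits)
  finally show ?thesis by simp
qed

text \<open>Caratheodory's condition for an open test set \<open>U\<close>. Lowering
  \<open>f\<close> by \<open>e\<close> leaves a function that vanishes off a closed set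
  \<open>C\<close> inside \<open>V\<close>. Any function below \<open>U - C\<close> can then be
  added to it without leaving \<open>below U\<close>, and \<open>U - C\<close> is an open superset
  of \<open>U - V\<close>. Lowering costs at most \<open>e\<close>, the value of \<open>L\<close> at
  the constant.\<close>

lemma outer_split_open:
  assumes U: "open U" and V: "open V"
  shows "outer (U \<inter> V) + outer (U - V) \<le> nu U"
proof -
  have *: "ennreal (L f) + outer (U - V) \<le> nu U" if f: "f \<in> below (U \<inter> V)" for f
  proof (rule ennreal_le_epsilon)
    fix e :: real assume e: "0 < e"
    have fb: "f \<in> bcf" and f0: "\<And>x. 0 \<le> f x" and f1: "\<And>x. f x \<le> indicator (U \<inter> V) x"
      using f by (auto simp: below_def)
    define f' where "f' x = max 0 (f x - e)" for x
    define C where "C = {x. e \<le> f x}"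
    have f'b: "f' \<in> bcf" unfolding f'_def by (intro bcf_max bcf_diff bcf_const fb)
    have "closed C" unfolding C_def
      by (intro closed_Collect_le continuous_on_const) (use fb in \<open>simp add: bcf_def\<close>)
    then have oUC: "open (U - C)" using U by (simp add: open_Diff)
    have CV: "C \<subseteq> V"
    proof
      fix x assume "x \<in> C"
      then have "0 < indicat_real (U \<inter> V) x" using f1[of x] e by (simp add: C_def)
      then show "x \<in> V" by (simp add: indicator_def split: if_splits)
    qed
    have L: "L f \<le> L f' + e"
    proof -
      have "L f \<le> L (\<lambda>x. f' x + e)"
        by (intro mono fb bcf_add f'b bcf_const) (auto simp: f'_def)
      then show ?thesis by (simp add: add f'b bcf_const const)
    qed
    have f'0: "0 \<le> L f'" by (intro nonneg f'b) (simp add: f'_def)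
    have "ennreal (L f') + ennreal (L g) \<le> nu U" if g: "g \<in> below (U - C)" for g
    proof -
      have gb: "g \<in> bcf" and g0: "\<And>x. 0 \<le> g x" and g1: "\<And>x. g x \<le> indicator (U - C) x"
        using g by (auto simp: below_def)
      have "f' x + g x \<le> indicator U x" for x
      proof (cases "x \<in> C")
        case True
        then have "g x \<le> 0" using g1[of x] by simp
        moreover have "f' x \<le> f x" using f0[of x] e by (simp add: f'_def)
        moreover have "indicator (U \<inter> V) x \<le> (indicator U x :: real)" by (simp add: indicator_def)
        then have "f x \<le> indicator U x" using f1[of x] by linarith
        ultimately show ?thesis by simp
      next
        case False
        then have "f' x = 0" by (simp add: f'_def C_def)
        then show ?thesis using g1[of x] False by (simp add: indicator_def split: if_splits)
      qed
      then have "(\<lambda>x. f' x + g x) \<in> below U"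
        using bcf_add[OF f'b gb] g0 by (simp add: below_def) (simp add: f'_def)
      from nu_upper[OF this] show ?thesis
        using f'b gb f'0 below_nonneg[OF g] by (simp add: add ennreal_plus)
    qed
    then have "(SUP g\<in>below (U - C). ennreal (L f') + ennreal (L g)) \<le> nu U"
      by (rule SUP_least)
    moreover have "below (U - C) \<noteq> {}" using zero_below by blast
    ultimately have "ennreal (L f') + nu (U - C) \<le> nu U"
      unfolding nu_def[of "U - C"] by (subst ennreal_SUP_add_right)
    moreover have "outer (U - V) \<le> nu (U - C)"
      unfolding outer_def using oUC CV by (intro INF_lower) auto
    ultimately have "ennreal (L f') + outer (U - V) \<le> nu U"
      using add_left_mono order_trans by blast
    then have step: "ennreal (L f') + outer (U - V) + ennreal e \<le> nu U + ennreal e"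
      by (rule add_right_mono)
    have "ennreal (L f) \<le> ennreal (L f') + ennreal e"
      using ennreal_leI[OF L] f'0 e by (simp add: ennreal_plus)
    then have "ennreal (L f) + outer (U - V) \<le> (ennreal (L f') + ennreal e) + outer (U - V)"
      by (rule add_right_mono)
    also have "\<dots> = ennreal (L f') + outer (U - V) + ennreal e" by (simp only: ac_simps)
    also note step
    finally show "ennreal (L f) + outer (U - V) \<le> nu U + ennreal e" .
  qed
  have "below (U \<inter> V) \<noteq> {}" using zero_below by blast
  then have "nu (U \<inter> V) + outer (U - V) \<le> nu U"
    unfolding nu_def[of "U \<inter> V"]
    by (subst ennreal_SUP_add_left[symmetric]) (auto intro: SUP_least *)
  then show ?thesis using outer_open[of "U \<inter> V"] U V by (simp add: open_Int)
qed

lemma outer_measure_space_outer: "outer_measure_space (Pow UNIV) outer"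
  unfolding outer_measure_space_def positive_def increasing_def countably_subadditive_def
  using outer_empty outer_mono outer_UN by auto

lemma open_in_lambda_system:
  assumes V: "open V"
  shows "V \<in> lambda_system UNIV (Pow UNIV) outer"
proof -
  have "outer (V \<inter> A) + outer ((UNIV - V) \<inter> A) = outer A" for A
  proof (rule antisym)
    have "outer A \<le> outer ((V \<inter> A) \<union> ((UNIV - V) \<inter> A))" by (rule outer_mono) auto
    then show "outer A \<le> outer (V \<inter> A) + outer ((UNIV - V) \<inter> A)"
      using outer_Un order_trans by blast
    show "outer (V \<inter> A) + outer ((UNIV - V) \<inter> A) \<le> outer A"
      unfolding outer_def[of A]
    proof (rule INF_greatest)
      fix U assume "U \<in> {U. open U \<and> A \<subseteq> U}"
      then have U: "open U" "A \<subseteq> U" by auto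
      have "outer (V \<inter> A) + outer ((UNIV - V) \<inter> A) \<le> outer (U \<inter> V) + outer (U - V)"
        by (intro add_mono outer_mono) (use U in auto)
      also have "\<dots> \<le> nu U" by (rule outer_split_open[OF U(1) V])
      finally show "outer (V \<inter> A) + outer ((UNIV - V) \<inter> A) \<le> nu U" .
    qed
  qed
  then show ?thesis by (simp add: lambda_system_def)
qed

section \<open>The representing measure\<close>

definition rep :: "'a measure" where
  "rep = measure_of UNIV (sets borel) outer"

lemma sets_rep: "sets rep = sets borel"
  unfolding rep_def by (metis sets.sets_measure_of_eq space_borel)

lemma emeasure_rep:
  assumes "A \<in> sets borel"
  shows "emeasure rep A = outer A"
proof -
  interpret P: sigma_algebra UNIV "Pow UNIV :: 'a set set" by (rule sigma_algebra_Pow)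
  have ms: "measure_space UNIV (lambda_system UNIV (Pow UNIV) outer) outer"
    by (rule P.caratheodory_lemma[OF outer_measure_space_outer])
  then interpret S: sigma_algebra UNIV "lambda_system UNIV (Pow UNIV) outer"
    by (simp add: measure_space_def)
  have "sets borel = sigma_sets UNIV {U::'a set. open U}" by (simp add: borel_def)
  also have "\<dots> \<subseteq> lambda_system UNIV (Pow UNIV) outer"
    by (rule S.sigma_sets_subset) (use open_in_lambda_system in blast)
  finally have "measure_space UNIV (sets borel) outer"
    using sets.sigma_algebra_axioms[of "borel :: 'a measure"]
    by (intro measure_down[OF ms]) (simp_all only: space_borel)
  then have "positive (sets rep) outer" "countably_additive (sets rep) outer"
    by (simp_all only: measure_space_def sets_rep)
  moreover have "A \<in> sets rep" using assms by (simp only: sets_rep)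
  ultimately show ?thesis by (intro emeasure_measure_of[OF rep_def]) simp_all
qed

lemma rep_prob: "rep \<in> prob_measures"
proof -
  have "emeasure rep UNIV = 1"
    using emeasure_rep[of UNIV] outer_open[of UNIV] nu_UNIV by simp
  moreover have "space rep = UNIV" using sets_eq_imp_space_eq[OF sets_rep] by simp
  ultimately show ?thesis using sets_rep by (auto simp: prob_measures_def intro!: prob_spaceI)
qed

text \<open>A layer cake estimate: \<open>real n * f\<close> is cut into \<open>n\<close> horizontal
  slices of height 1, each lying below its open superlevel set \<open>G k\<close>, whose measure
  dominates \<open>L\<close> by the definition of \<open>nu\<close>. One inequality is enough,
  because it will also be applied to the complement of the function.\<close>

lemma le_integral_rep_01:
  assumes f: "f \<in> bcf" and f01: "\<And>x. 0 \<le> f x" "\<And>x. f x \<le> 1"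
  shows "L f \<le> integral\<^sup>L rep f"
proof -
  interpret prob_space rep using prob_measuresD[OF rep_prob] by simp
  have bound: "real n * L f \<le> real n * integral\<^sup>L rep f + 1" for n
  proof -
    define p where "p k x = min 1 (max 0 (real n * f x - real k))" for k :: nat and x
    define G where "G k = {x. real k < real n * f x}" for k :: nat
    have pb: "p k \<in> bcf" for k
      unfolding p_def by (intro bcf_min bcf_max bcf_diff bcf_cmult bcf_const f)
    have oG: "open (G k)" for k unfolding G_def
      by (intro open_Collect_less continuous_on_const continuous_on_mult) (use f in \<open>simp add: bcf_def\<close>)
    have G[measurable]: "G k \<in> sets rep" for k using oG by (simp add: sets_rep)
    have "p k \<in> below (G k)" for k
      using pb by (auto simp: below_def p_def G_def indicator_def)
    from nu_upper[OF this] have "ennreal (L (p k)) \<le> emeasure rep (G k)" for k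
      using oG[of k] by (simp add: emeasure_rep outer_open)
    then have Lp: "L (p k) \<le> measure rep (G k)" for k
      by (simp add: emeasure_eq_measure)
    have s1: "(\<Sum>k<N. min 1 (max 0 (t - real k))) = min (real N) t" if "0 \<le> t" for N and t :: real
      using that by (induction N) auto
    \<comment> \<open>Counting levels overshoots by at most 1. This is the whole discretization
      error, and it becomes negligible after division by \<open>real n\<close>.\<close>
    have s2: "(\<Sum>k<N. if real k < t then 1 else 0) \<le> min (real N) (t + 1)" if "0 \<le> t" for N and t :: real
      using that by (induction N) auto
    have "real n * f x = (\<Sum>k<n. p k x)" for x
      using s1[of "real n * f x" n] f01[of x] mult_left_mono[OF f01(2), of "real n" x] by (simp add: p_def)
    then have "real n * L f = L (\<lambda>x. \<Sum>k<n. p k x)"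
      using scale[OF f, of "real n"] by simp
    also have "\<dots> = (\<Sum>k<n. L (p k))" by (intro sum pb)
    also have "\<dots> \<le> (\<Sum>k<n. measure rep (G k))" by (intro sum_mono Lp)
    also have "\<dots> = (\<integral>x. (\<Sum>k<n. indicator (G k) x) \<partial>rep)"
      by (subst Bochner_Integration.integral_sum) (auto simp: emeasure_eq_measure)
    also have "\<dots> \<le> (\<integral>x. real n * f x + 1 \<partial>rep)"
    proof (rule integral_mono)
      show "integrable rep (\<lambda>x. \<Sum>k<n. indicat_real (G k) x)"
        by (intro Bochner_Integration.integrable_sum) (auto simp: emeasure_eq_measure)
      show "integrable rep (\<lambda>x. real n * f x + 1)"
        by (intro integrable_bcf[OF rep_prob] bcf_add bcf_cmult bcf_const f)
      show "(\<Sum>k<n. indicat_real (G k) x) \<le> real n * f x + 1" for x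
      proof -
        have "(\<Sum>k<n. indicat_real (G k) x) = (\<Sum>k<n. if real k < real n * f x then 1 else 0)"
          by (intro sum.cong) (auto simp: G_def indicator_def)
        also have "\<dots> \<le> min (real n) (real n * f x + 1)" by (rule s2) (simp add: f01)
        finally show ?thesis by (rule order_trans) simp
      qed
    qed
    also have "\<dots> = real n * integral\<^sup>L rep f + 1"
      using integrable_bcf[OF rep_prob f] prob_space by simp
    finally show ?thesis .
  qed
  show ?thesis
  proof (rule ccontr)
    assume "\<not> ?thesis"
    then have d: "0 < L f - integral\<^sup>L rep f" by simp
    then obtain n :: nat where "1 < real n * (L f - integral\<^sup>L rep f)"
      using reals_Archimedean3 by blast
    with bound[of n] show False by (simp add: algebra_simps)
  qed
qed

lemma integral_rep:
  assumes f: "f \<in> bcf"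
  shows "L f = integral\<^sup>L rep f"
proof -
  interpret prob_space rep using prob_measuresD[OF rep_prob] by simp
  obtain B where B: "B > 0" "\<And>x. \<bar>f x\<bar> \<le> B"
  proof -
    obtain B where "B \<ge> 0" "\<And>x. \<bar>f x\<bar> \<le> B" using bcf_bound[OF f] by blast
    then show ?thesis by (intro that[of "B + 1"]) (auto intro: add_increasing2)
  qed
  \<comment> \<open>With this factor \<open>c * f\<close> takes values between -1/2 and 1/2, so that
    both \<open>g\<close> and its complement lie between 0 and 1. The one-sided estimate applied to
    both gives equality.\<close>
  define c where "c = 1 / (2 * B)"
  have c: "c > 0" using B(1) by (simp add: c_def)
  define g where "g x = c * f x + 1/2" for x
  have gb: "g \<in> bcf" unfolding g_def by (intro bcf_add bcf_cmult bcf_const f)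
  have g01: "0 \<le> g x" "g x \<le> 1" for x
  proof -
    have "\<bar>c * f x\<bar> \<le> c * B" using B(2)[of x] c by (simp add: abs_mult)
    moreover have "c * B = 1/2" using B(1) by (simp add: c_def)
    ultimately show "0 \<le> g x" "g x \<le> 1" unfolding g_def by linarith+
  qed
  have g1b: "(\<lambda>x. 1 - g x) \<in> bcf" by (intro bcf_diff bcf_const gb)
  have "L g \<le> integral\<^sup>L rep g"
    by (rule le_integral_rep_01[OF gb g01])
  moreover have "L (\<lambda>x. 1 - g x) \<le> integral\<^sup>L rep (\<lambda>x. 1 - g x)"
    by (rule le_integral_rep_01[OF g1b]) (use g01 in auto)
  moreover have "L (\<lambda>x. 1 - g x) = 1 - L g"
    using add[OF g1b gb] one by simp
  moreover have "integral\<^sup>L rep (\<lambda>x. 1 - g x) = 1 - integral\<^sup>L rep g"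
    using integrable_bcf[OF rep_prob gb] prob_space by simp
  ultimately have "L g = integral\<^sup>L rep g" by linarith
  moreover have "L g = c * L f + 1/2"
    unfolding g_def using add[OF bcf_cmult[OF f] bcf_const, of c "1/2"] by (simp add: scale f const)
  moreover have "integral\<^sup>L rep g = c * integral\<^sup>L rep f + 1/2"
    unfolding g_def using integrable_bcf[OF rep_prob f] prob_space by simp
  ultimately show ?thesis using c by simp
qed

end

subsection \<open>Tightness and cluster points\<close>

text \<open>Integration against \<open>\<mu> i\<close> is a point of a product of compact intervals,
  one for each test function, so these points cluster by Tychonoff's theorem. The neighbourhood
  filter of the cluster point is pulled back to the index set, so that all other limits along
  \<open>H\<close> persist along \<open>G\<close>.\<close>

lemma cluster_functional:
  fixes \<mu> :: "'i \<Rightarrow> 'a::metric_space measure"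
  assumes H: "H \<noteq> bot" and P: "\<forall>\<^sub>F i in H. \<mu> i \<in> prob_measures"
  obtains G L where "G \<noteq> bot" "G \<le> H" "\<And>f. f \<in> bcf \<Longrightarrow> ((\<lambda>i. integral\<^sup>L (\<mu> i) f) \<longlongrightarrow> L f) G"
proof -
  \<comment> \<open>The product runs over all functions. The default 0 outside \<open>bcf\<close>
    keeps those coordinates in a compact interval too; the absolute values in \<open>K\<close>
    guarantee that every interval contains 0.\<close>
  define \<Phi> where "\<Phi> i f = (if f \<in> bcf then integral\<^sup>L (\<mu> i) f else 0)" for i and f :: "'a \<Rightarrow> real"
  have "\<exists>B. f \<in> bcf \<longrightarrow> (\<forall>x. \<bar>f x\<bar> \<le> B)" for f :: "'a \<Rightarrow> real"
    using bcf_bound by blast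
  then obtain B where B: "\<And>f x. f \<in> bcf \<Longrightarrow> \<bar>f (x::'a)\<bar> \<le> B f" by metis
  define K where "K = (\<Pi>\<^sub>E f\<in>UNIV. {- \<bar>B f\<bar>..\<bar>B f\<bar>})"
  have "compactin (product_topology (\<lambda>_. euclidean) UNIV) K"
    unfolding K_def compactin_PiE by (simp add: compactin_euclidean_iff)
  then have K: "compact K"
    by (simp add: euclidean_product_topology compactin_euclidean_iff)
  have "\<forall>\<^sub>F i in H. \<Phi> i \<in> K"
    using P
  proof eventually_elim
    case (elim i)
    have "\<bar>\<Phi> i f\<bar> \<le> \<bar>B f\<bar>" for f
    proof (cases "f \<in> bcf")
      case True
      have "\<bar>integral\<^sup>L (\<mu> i) f\<bar> \<le> B f" by (rule integral_bcf_bound[OF elim True B[OF True]])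
      then show ?thesis using True by (simp add: \<Phi>_def)
    qed (simp add: \<Phi>_def)
    then have "- \<bar>B f\<bar> \<le> \<Phi> i f \<and> \<Phi> i f \<le> \<bar>B f\<bar>" for f
      by (metis abs_le_iff minus_le_iff)
    then show ?case by (simp add: K_def PiE_def)
  qed
  then have "eventually (\<lambda>h. h \<in> K) (filtermap \<Phi> H)" by (simp add: eventually_filtermap)
  moreover have "filtermap \<Phi> H \<noteq> bot" using H by (simp add: filtermap_bot_iff)
  ultimately obtain L where L: "inf (nhds L) (filtermap \<Phi> H) \<noteq> bot"
    using K unfolding compact_filter by blast
  define G where "G = inf (filtercomap \<Phi> (nhds L)) H"
  show ?thesis
  proof (rule that)
    show "G \<le> H" by (simp add: G_def)
    show "G \<noteq> bot"
    proof
      assume "G = bot"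
      then have "eventually (\<lambda>_. False) G" by simp
      then obtain P Q where "eventually P (filtercomap \<Phi> (nhds L))" "eventually Q H"
          and PQ: "\<And>i. P i \<Longrightarrow> Q i \<Longrightarrow> False"
        unfolding G_def eventually_inf by auto
      then obtain R where R: "eventually R (nhds L)" "\<And>i. R (\<Phi> i) \<Longrightarrow> P i"
        unfolding eventually_filtercomap by blast
      have "eventually (\<lambda>h. \<not> R h) (filtermap \<Phi> H)"
        unfolding eventually_filtermap
        by (rule eventually_mono[OF \<open>eventually Q H\<close>]) (use R(2) PQ in blast)
      then have "eventually (\<lambda>_. False) (inf (nhds L) (filtermap \<Phi> H))"
        unfolding eventually_inf using R(1) by blast
      then show False using L by (simp add: eventually_False)
    qed
    have "filterlim \<Phi> (nhds L) G"
      unfolding filterlim_iff_le_filtercomap by (simp add: G_def)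
    moreover have "continuous_on UNIV (\<lambda>h::('a \<Rightarrow> real) \<Rightarrow> real. h f)" for f
      by (rule continuous_on_product_coordinates)
    ultimately have \<Phi>_lim: "((\<lambda>i. \<Phi> i f) \<longlongrightarrow> L f) G" for f
      by (intro continuous_on_tendsto_compose[of UNIV "\<lambda>h. h f" \<Phi> L G]) simp_all
    then show "((\<lambda>i. integral\<^sup>L (\<mu> i) f) \<longlongrightarrow> L f) G" if "f \<in> bcf" for f
      using \<Phi>_lim[of f] that by (simp add: \<Phi>_def)
  qed
qed

lemma Dini_zero:
  fixes r :: "nat \<Rightarrow> 'a::metric_space \<Rightarrow> real"
  assumes cont: "\<And>n. continuous_on UNIV (r n)" and dec: "\<And>n x. r (Suc n) x \<le> r n x"
    and lim: "\<And>x. (\<lambda>n. r n x) \<longlonglongrightarrow> 0" and K: "compact K" and e: "0 < e"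
  shows "\<exists>N. \<forall>n\<ge>N. \<forall>x\<in>K. r n x < e"
proof -
  have mono: "r n x \<le> r m x" if "m \<le> n" for m n x
    using that dec by (rule lift_Suc_antimono_le[rotated])
  have op: "open {x. r n x < e}" for n
    by (intro open_Collect_less cont continuous_on_const)
  have "K \<subseteq> (\<Union>n\<in>UNIV. {x. r n x < e})"
  proof
    fix x assume "x \<in> K"
    from order_tendstoD(2)[OF lim[of x] e] obtain n where "r n x < e"
      by (auto simp: eventually_sequentially)
    then show "x \<in> (\<Union>n\<in>UNIV. {x. r n x < e})" by blast
  qed
  then obtain I where I: "finite I" "K \<subseteq> (\<Union>n\<in>I. {x. r n x < e})"
    by (rule compactE_image[OF K, of UNIV "\<lambda>n. {x. r n x < e}", OF op]) auto
  have N: "n \<le> Max I" if "n \<in> I" for n using I(1) that by (rule Max_ge)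
  have "r n x < e" if "n \<ge> Max I" "x \<in> K" for n x
  proof -
    obtain i where "i \<in> I" "r i x < e" using subsetD[OF I(2) \<open>x \<in> K\<close>] by auto
    moreover have "r n x \<le> r i x" using N[OF \<open>i \<in> I\<close>] \<open>n \<ge> Max I\<close> by (intro mono) simp
    ultimately show ?thesis by linarith
  qed
  then show ?thesis by blast
qed

text \<open>Tightness supplies the continuity of the cluster functional along decreasing sequences.
  On a compact set Dini's theorem makes the functions uniformly small, and off it their uniform
  bound is multiplied by a small mass. Each compact set has to work only eventually along
  \<open>H\<close>, which is the form that laws of large numbers provide.\<close>

lemma Prokhorov_cluster:
  fixes \<mu> :: "'i \<Rightarrow> 'a::metric_space measure"
  assumes H: "H \<noteq> bot" and P: "\<forall>\<^sub>F i in H. \<mu> i \<in> prob_measures"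
    and tight: "\<And>e. 0 < e \<Longrightarrow> \<exists>K. compact K \<and> (\<forall>\<^sub>F i in H. measure (\<mu> i) (- K) < e)"
  obtains G m where "G \<noteq> bot" "G \<le> H" "limitin weak_topology \<mu> m G"
proof -
  obtain G L where G: "G \<noteq> bot" "G \<le> H"
    and L: "\<And>f. f \<in> bcf \<Longrightarrow> ((\<lambda>i. integral\<^sup>L (\<mu> i) f) \<longlongrightarrow> L f) G"
    by (rule cluster_functional[OF H P]) blast
  have PG: "\<forall>\<^sub>F i in G. \<mu> i \<in> prob_measures" using P G(2) by (rule filter_leD[rotated])
  have Leq: "L f = c" if "f \<in> bcf" "((\<lambda>i. integral\<^sup>L (\<mu> i) f) \<longlongrightarrow> c) G" for f c
    using tendsto_unique[OF G(1) L[OF that(1)] that(2)] .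
  have lmono: "L f \<le> L g" if fg: "f \<in> bcf" "g \<in> bcf" "\<And>x. f x \<le> g x" for f g
  proof (rule tendsto_le[OF G(1) L[OF fg(2)] L[OF fg(1)]])
    show "\<forall>\<^sub>F i in G. integral\<^sup>L (\<mu> i) f \<le> integral\<^sup>L (\<mu> i) g"
      using PG by eventually_elim (intro integral_mono integrable_bcf fg; simp)
  qed
  interpret smooth_functional L
  proof
    fix f g :: "'a \<Rightarrow> real" assume f: "f \<in> bcf" and g: "g \<in> bcf"
    show "L (\<lambda>x. f x + g x) = L f + L g"
    proof (rule Leq[OF bcf_add[OF f g]])
      have "\<forall>\<^sub>F i in G. integral\<^sup>L (\<mu> i) f + integral\<^sup>L (\<mu> i) g = (\<integral>x. f x + g x \<partial>\<mu> i)"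
        using PG by eventually_elim (simp add: integrable_bcf f g)
      then show "((\<lambda>i. \<integral>x. f x + g x \<partial>\<mu> i) \<longlongrightarrow> L f + L g) G"
        using tendsto_add[OF L[OF f] L[OF g]] by (rule Lim_transform_eventually[rotated])
    qed
  next
    fix f :: "'a \<Rightarrow> real" and c assume f: "f \<in> bcf"
    show "L (\<lambda>x. c * f x) = c * L f"
      using tendsto_mult_left[OF L[OF f], of c] by (intro Leq[OF bcf_cmult[OF f]]) simp
  next
    fix f g :: "'a \<Rightarrow> real" assume "f \<in> bcf" "g \<in> bcf" "\<And>x. f x \<le> g x"
    then show "L f \<le> L g" by (rule lmono)
  next
    show "L (\<lambda>_. 1) = 1"
    proof (rule Leq[OF bcf_const tendsto_eventually])
      show "\<forall>\<^sub>F i in G. (\<integral>x. 1 \<partial>\<mu> i) = (1::real)"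
        using PG
      proof eventually_elim
        case (elim i)
        then show ?case using prob_space.prob_space[of "\<mu> i"] by (simp add: prob_measuresD)
      qed
    qed
  next
    fix r :: "nat \<Rightarrow> 'a \<Rightarrow> real"
    assume r: "\<And>n. r n \<in> bcf" and dec: "\<And>n x. r (Suc n) x \<le> r n x" and lim: "\<And>x. (\<lambda>n. r n x) \<longlonglongrightarrow> 0"
    have mono: "r n x \<le> r m x" if "m \<le> n" for m n x
      using that dec by (rule lift_Suc_antimono_le[rotated])
    have r0: "0 \<le> r n x" for n x
      by (rule LIMSEQ_le_const2[OF lim[of x]]) (use mono in blast)
    have Lr0: "0 \<le> L (r n)" for n
      using lmono[OF bcf_const r, of 0 n] r0 Leq[OF bcf_const, of 0 0] by simp
    obtain B where B: "0 < B" "\<And>x. r 0 x \<le> B"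
    proof -
      obtain B where B: "0 \<le> B" "\<And>x. \<bar>r 0 x\<bar> \<le> B" using bcf_bound[OF r] by blast
      have "r 0 x \<le> B + 1" for x using B(2)[of x] by simp
      with B(1) show ?thesis by (intro that[of "B + 1"]) auto
    qed
    show "(\<lambda>n. L (r n)) \<longlonglongrightarrow> 0"
    proof (rule LIMSEQ_I)
      fix e :: real assume e: "0 < e"
      \<comment> \<open>Chosen so that \<open>d + B * d\<close> equals \<open>e / 2\<close>:
        \<open>d\<close> bounds the function on \<open>K\<close>, and \<open>B * d\<close> bounds
        its integral over the complement.\<close>
      define d where "d = e / (2 * (1 + B))"
      have "d + B * d = e / 2" using B(1) by (simp add: d_def divide_simps) (simp add: algebra_simps)
      with e B(1) have d: "0 < d" "d + B * d < e" by (auto simp: d_def)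
      obtain K where K: "compact K" "\<forall>\<^sub>F i in H. measure (\<mu> i) (- K) < d"
        using tight[OF d(1)] by blast
      obtain N where N: "\<And>n x. n \<ge> N \<Longrightarrow> x \<in> K \<Longrightarrow> r n x < d"
        using Dini_zero[where r=r, OF _ dec lim K(1) d(1)] r unfolding bcf_def by blast
      have "norm (L (r n) - 0) < e" if n: "n \<ge> N" for n
      proof -
        have "\<forall>\<^sub>F i in G. integral\<^sup>L (\<mu> i) (r n) \<le> d + B * d"
          using PG filter_leD[OF G(2) K(2)]
        proof eventually_elim
          case (elim i)
          interpret M: prob_space "\<mu> i" using prob_measuresD[OF elim(1)] by simp
          have Km: "- K \<in> sets (\<mu> i)"
            using K(1) by (simp add: prob_measuresD[OF elim(1)] compact_imp_closed borel_closed)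
          have "r n x \<le> d + B * indicator (- K) x" for x
            using N[OF n, of x] mono[of 0 n x] B(2)[of x] d(1)
            by (cases "x \<in> K") (auto intro: add_increasing)
          then have "integral\<^sup>L (\<mu> i) (r n) \<le> (\<integral>x. d + B * indicator (- K) x \<partial>\<mu> i)"
            using Km by (intro integral_mono integrable_bcf[OF elim(1) r]) (auto simp: M.emeasure_eq_measure)
          also have "\<dots> = d + B * measure (\<mu> i) (- K)"
            using Km M.prob_space by (simp add: M.emeasure_eq_measure prob_measuresD[OF elim(1)])
          also have "\<dots> \<le> d + B * d" using elim(2) B(1) by simp
          finally show ?case .
        qed
        then have "L (r n) \<le> d + B * d"
          by (rule tendsto_upperbound[OF L[OF r] _ G(1)])
        then show ?thesis using Lr0[of n] d(2) by simp
      qed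
      then show "\<exists>N. \<forall>n\<ge>N. norm (L (r n) - 0) < e" by blast
    qed
  qed
  have "limitin weak_topology \<mu> rep G"
    unfolding limitin_weak_topology using rep_prob PG L integral_rep by auto
  with G that show ?thesis by blast
qed

subsection \<open>Averages of independent variables\<close>

text \<open>For bounded variables Hoeffding's inequality makes the probability of a fixed deviation
  decay geometrically. The probabilities are therefore summable, and the Borel-Cantelli lemma gives
  the strong law.\<close>

lemma AE_average_tendsto:
  fixes X :: "nat \<Rightarrow> 'o \<Rightarrow> real"
  assumes P: "prob_space P" and indep: "prob_space.indep_vars P (\<lambda>_. borel) X UNIV"
    and bound: "\<And>i x. \<bar>X i x\<bar> \<le> B" and mean: "\<And>i. integral\<^sup>L P (X i) = c"
  shows "AE x in P. (\<lambda>n. (\<Sum>k<n. X k x) / real n) \<longlonglongrightarrow> c"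
proof -
  interpret prob_space P by (rule P)
  \<comment> \<open>The added 1 makes \<open>b\<close> strictly positive, as the division by its
    square in Hoeffding's exponent requires.\<close>
  define b where "b = \<bar>B\<bar> + 1"
  have b: "b > 0" "\<And>i x. \<bar>X i x\<bar> \<le> b"
    using bound by (auto simp: b_def intro: order_trans[OF bound])
  have meas[measurable]: "X i \<in> borel_measurable P" for i
    using indep by (auto simp: indep_vars_def)
  have dev: "AE x in P. \<forall>\<^sub>F n in sequentially. \<bar>(\<Sum>k<n. X k x) / real n - c\<bar> < d" if d: "0 < d" for d
  proof -
    define A where "A n = {x \<in> space P. real n * d \<le> \<bar>(\<Sum>k<n. X k x) - real n * c\<bar>}" for n
    have A[measurable]: "A n \<in> sets P" for n unfolding A_def by measurable
    \<comment> \<open>Hoeffding's exponent for \<open>n\<close> variables of range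
      \<open>2 * b\<close> and deviation \<open>real n * d\<close> is \<open>n\<close> times this
      exponent.\<close>
    define q where "q = exp (- (d\<^sup>2 / (2 * b\<^sup>2)))"
    have q: "0 < q" "q < 1" using b(1) d by (auto simp: q_def)
    have le: "prob (A n) \<le> 2 * q ^ n" for n
    proof (cases "n = 0")
      case True
      then show ?thesis using order_trans[OF prob_le_1, of 2 "A n"] by simp
    next
      case False
      interpret Hoeffding_ineq P "{..<n}" X "\<lambda>_. - b" "\<lambda>_. b" "\<Sum>i<n. expectation (X i)"
      proof unfold_locales
        show "indep_vars (\<lambda>_. borel) X {..<n}" by (rule indep_vars_subset[OF indep]) simp
        show "AE x in P. X i x \<in> {- b..b}" if "i \<in> {..<n}" for i
        proof (rule AE_I2)
          show "X i x \<in> {- b..b}" for x using b(2)[of i x] by (simp add: abs_le_iff)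
        qed
      qed simp_all
      have "prob (A n) \<le> 2 * exp (-2 * (real n * d)\<^sup>2 / (\<Sum>i<n. (b - - b)\<^sup>2))"
        using Hoeffding_ineq_abs_ge[of "real n * d"] b(1) d False by (simp add: A_def mean)
      also have "-2 * (real n * d)\<^sup>2 / (\<Sum>i<n. (b - - b)\<^sup>2) = real n * (- (d\<^sup>2 / (2 * b\<^sup>2)))"
        using b(1) False by (simp add: field_simps power2_eq_square)
      also have "exp (real n * (- (d\<^sup>2 / (2 * b\<^sup>2)))) = q ^ n"
        unfolding q_def by (rule exp_of_nat_mult)
      finally show ?thesis .
    qed
    have "summable (\<lambda>n. 2 * q ^ n)" using q by (intro summable_mult summable_geometric) simp
    then have "summable (\<lambda>n. prob (A n))"
      by (rule summable_comparison_test'[where N=0]) (use le in simp)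
    then have "AE x in P. \<forall>\<^sub>F n in sequentially. x \<in> space P - A n"
      by (intro borel_cantelli_AE1) (auto simp: emeasure_eq_measure)
    then show ?thesis
    proof eventually_elim
      case (elim x)
      show ?case using elim eventually_gt_at_top[of "0::nat"]
      proof eventually_elim
        case (elim n)
        then have "\<bar>(\<Sum>k<n. X k x) - real n * c\<bar> < real n * d" by (auto simp: A_def)
        moreover have "(\<Sum>k<n. X k x) / real n - c = ((\<Sum>k<n. X k x) - real n * c) / real n"
          using elim(2) by (simp add: field_simps)
        ultimately show ?case using elim(2) by (simp add: field_simps)
      qed
    qed
  qed
  \<comment> \<open>The exceptional set depends on the tolerance, so only countably many tolerances
    are taken.\<close>
  have "AE x in P. \<forall>j::nat. \<forall>\<^sub>F n in sequentially. \<bar>(\<Sum>k<n. X k x) / real n - c\<bar> < 1 / real (Suc j)"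
    unfolding AE_all_countable by (intro allI dev) simp
  then show ?thesis
  proof eventually_elim
    case (elim x)
    show ?case
    proof (rule tendstoI)
      fix e :: real assume "0 < e"
      then obtain j where j: "1 / real (Suc j) < e"
        using nat_approx_posE by blast
      show "\<forall>\<^sub>F n in sequentially. dist ((\<Sum>k<n. X k x) / real n) c < e"
        using elim[rule_format, of j] by eventually_elim (use j in \<open>simp add: dist_real_def\<close>)
    qed
  qed
qed

lemma AE_average_function:
  fixes W :: "nat \<Rightarrow> 'o \<Rightarrow> 'w::topological_space" and g :: "'w \<Rightarrow> real"
  assumes P: "prob_space P" and indep: "prob_space.indep_vars P (\<lambda>_. borel) W UNIV"
    and meas: "\<And>i. W i \<in> measurable P borel" and law: "\<And>i. distr P borel (W i) = lam"
    and g: "g \<in> borel_measurable borel" and bound: "\<And>w. \<bar>g w\<bar> \<le> B"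
  shows "AE x in P. (\<lambda>n. (\<Sum>k<n. g (W k x)) / real n) \<longlonglongrightarrow> integral\<^sup>L lam g"
proof (rule AE_average_tendsto[OF P])
  interpret prob_space P by (rule P)
  show "indep_vars (\<lambda>_. borel) (\<lambda>k x. g (W k x)) UNIV"
    by (rule indep_vars_compose2[OF indep]) (use g in simp)
  show "integral\<^sup>L P (\<lambda>x. g (W i x)) = integral\<^sup>L lam g" for i
    using integral_distr[OF meas g, of i] law by simp
qed (rule bound)

subsection \<open>Empirical measures\<close>

text \<open>As an image of the uniform law on the indices, an empirical measure inherits its
  integrals from finite sums.\<close>

lemma empirical_eq_distr:
  assumes "n > 0"
  shows "empirical n z = distr (uniform_count_measure {..<n}) borel z"
proof -
  let ?M = "distr (uniform_count_measure {..<n}) borel z"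
  have "(\<Sum>k<n. emeasure (return borel (z k)) A) / of_nat n = emeasure ?M A" if A: "A \<in> sets borel" for A
  proof -
    have "emeasure ?M A = emeasure (uniform_count_measure {..<n}) (z -` A \<inter> {..<n})"
      using A by (subst emeasure_distr) (auto simp: space_uniform_count_measure)
    also have "\<dots> = ennreal (real (card (z -` A \<inter> {..<n})) / real n)"
      by (subst emeasure_uniform_count_measure) auto
    also have "\<dots> = ennreal (\<Sum>k<n. indicator A (z k)) / of_nat n"
      using assms by (subst divide_ennreal[symmetric])
        (auto simp: indicator_def ennreal_of_nat_eq_real_of_nat sum.If_cases Int_def vimage_def conj_commute)
    also have "ennreal (\<Sum>k<n. indicator A (z k)) = (\<Sum>k<n. emeasure (return borel (z k)) A)"
      using A by (subst sum_ennreal[symmetric]) (auto simp: ennreal_indicator)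
    finally show ?thesis by simp
  qed
  then have "empirical n z = measure_of UNIV (sets borel) (emeasure ?M)"
    unfolding empirical_def
    by (intro measure_of_eq) (auto simp: sets.sigma_sets_eq[of borel, simplified])
  also have "\<dots> = ?M" using measure_of_of_measure[of ?M] by simp
  finally show ?thesis .
qed

lemma prob_measures_empirical:
  assumes "n > 0" shows "empirical n z \<in> prob_measures"
proof -
  have "prob_space (uniform_count_measure {..<n})"
    using assms by (intro prob_space_uniform_count_measure) auto
  then show ?thesis unfolding empirical_eq_distr[OF assms] prob_measures_def
    by (auto intro!: prob_space.prob_space_distr)
qed

lemma integral_empirical:
  fixes f :: "_ \<Rightarrow> real"
  assumes "n > 0" "f \<in> borel_measurable borel"
  shows "integral\<^sup>L (empirical n z) f = (\<Sum>k<n. f (z k)) / real n"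
  unfolding empirical_eq_distr[OF assms(1)]
  using assms by (subst integral_distr) (auto simp: integral_uniform_count_measure)

lemma integral_empirical_bcf:
  assumes "n > 0" "f \<in> bcf"
  shows "integral\<^sup>L (empirical n z) f = (\<Sum>k<n. f (z k)) / real n"
  using assms by (intro integral_empirical measurable_bcf) auto

lemma measure_empirical:
  assumes "n > 0" "A \<in> sets borel"
  shows "measure (empirical n z) A = (\<Sum>k<n. indicator A (z k)) / real n"
  using integral_empirical[OF assms(1), of "indicator A" z] assms
    prob_measuresD[OF prob_measures_empirical[OF assms(1), of z]] by simp

lemma measure_empirical_pos:
  assumes "n > 0" "A \<in> sets borel" "measure (empirical n z) A > 0"
  shows "\<exists>k<n. z k \<in> A"
proof (rule ccontr)
  assume "\<not> ?thesis"
  then have "(\<Sum>k<n. indicator A (z k)) = (0::real)" by (intro sum.neutral) (auto simp: indicator_def)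
  with assms show False by (simp add: measure_empirical)
qed

text \<open>A test function bounded by \<open>B\<close> changes its average by at most
  \<open>2 * B / real (N i)\<close>, whichever index moves and wherever it goes. Hence
  \<open>k i\<close> and the new value may vary arbitrarily with \<open>i\<close>.\<close>

lemma limitin_empirical_change_one:
  fixes m :: "'a::topological_space measure"
  assumes lim: "limitin weak_topology (\<lambda>i. empirical (N i) (z i)) m G"
    and N: "filterlim N at_top G"
    and diff: "\<And>i j. j \<noteq> k i \<Longrightarrow> z' i j = z i j"
  shows "limitin weak_topology (\<lambda>i. empirical (N i) (z' i)) m G"
  unfolding limitin_weak_topology
proof (intro conjI ballI)
  show "m \<in> prob_measures" using lim by (simp add: limitin_weak_topology)
  have N0: "\<forall>\<^sub>F i in G. N i > 0" by (rule eventually_compose_filterlim[OF eventually_gt_at_top N])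
  then show "\<forall>\<^sub>F i in G. empirical (N i) (z' i) \<in> prob_measures"
    by eventually_elim (rule prob_measures_empirical)
  fix f :: "'a \<Rightarrow> real" assume f: "f \<in> bcf"
  obtain B where B: "B \<ge> 0" "\<And>x. \<bar>f x\<bar> \<le> B" using bcf_bound[OF f] by blast
  have "((\<lambda>i. integral\<^sup>L (empirical (N i) (z' i)) f - integral\<^sup>L (empirical (N i) (z i)) f) \<longlongrightarrow> 0) G"
  proof (rule Lim_null_comparison)
    show "\<forall>\<^sub>F i in G. norm (integral\<^sup>L (empirical (N i) (z' i)) f - integral\<^sup>L (empirical (N i) (z i)) f)
        \<le> 2 * B / real (N i)"
      using N0
    proof eventually_elim
      case (elim i)
      have "\<bar>\<Sum>j<N i. f (z' i j) - f (z i j)\<bar> \<le> (\<Sum>j<N i. \<bar>f (z' i j) - f (z i j)\<bar>)"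
        by (rule sum_abs)
      also have "\<dots> \<le> (\<Sum>j<N i. if j = k i then 2 * B else 0)"
      proof (rule sum_mono)
        fix j
        have "\<bar>f (z' i j) - f (z i j)\<bar> \<le> 2 * B" using B(2)[of "z' i j"] B(2)[of "z i j"] by linarith
        then show "\<bar>f (z' i j) - f (z i j)\<bar> \<le> (if j = k i then 2 * B else 0)"
          using diff[of j i] by auto
      qed
      also have "\<dots> \<le> 2 * B" using B(1) by (simp add: sum.delta)
      finally have "\<bar>\<Sum>j<N i. f (z' i j) - f (z i j)\<bar> / real (N i) \<le> 2 * B / real (N i)"
        by (intro divide_right_mono) auto
      then show ?case
        using elim by (simp add: integral_empirical_bcf f sum_subtractf flip: diff_divide_distrib)
    qed
    have "filterlim (\<lambda>i. real (N i)) at_top G"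
      using filterlim_compose[OF filterlim_real_sequentially N] .
    then show "((\<lambda>i. 2 * B / real (N i)) \<longlongrightarrow> 0) G"
      by (rule tendsto_divide_0[OF tendsto_const filterlim_at_top_imp_at_infinity])
  qed
  moreover have "((\<lambda>i. integral\<^sup>L (empirical (N i) (z i)) f) \<longlongrightarrow> integral\<^sup>L m f) G"
    using lim f by (simp add: limitin_weak_topology)
  ultimately show "((\<lambda>i. integral\<^sup>L (empirical (N i) (z' i)) f) \<longlongrightarrow> integral\<^sup>L m f) G"
    using tendsto_add by fastforce
qed

subsection \<open>Limits of equilibria\<close>

text \<open>The action type is merely a metric space, so second countability has to come from
  compactness: balls around finite nets of radius \<open>1 / real (Suc n)\<close>.\<close>

lemma compact_countable_basis:
  assumes "compact (UNIV :: 'x::metric_space set)"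
  obtains B :: "'x::metric_space set set" where "countable B" "topological_basis B"
proof -
  have "\<forall>n::nat. \<exists>k. finite k \<and> (UNIV :: 'x set) \<subseteq> (\<Union>x\<in>k. ball x (1 / real (Suc n)))"
  proof
    fix n :: nat
    have "0 < 1 / real (Suc n)" by simp
    then show "\<exists>k. finite k \<and> (UNIV :: 'x set) \<subseteq> (\<Union>x\<in>k. ball x (1 / real (Suc n)))"
      using seq_compact_imp_totally_bounded[OF compact_imp_seq_compact[OF assms]] by blast
  qed
  from choice[OF this] obtain k where
    *: "\<forall>n. finite (k n) \<and> (UNIV :: 'x set) \<subseteq> (\<Union>x\<in>k n. ball x (1 / real (Suc n)))" ..
  then have k: "finite (k n)" "x \<in> (\<Union>a\<in>k n. ball a (1 / real (Suc n)))" for n x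
    by blast+
  define B where "B = (\<Union>n. (\<lambda>a. ball a (1 / real (Suc n))) ` k n)"
  show ?thesis
  proof (rule that)
    show "countable B" unfolding B_def by (intro countable_UN countable_image) (simp_all add: k countable_finite)
    show "topological_basis B"
    proof (rule topological_basisI)
      fix O' and x :: 'x assume O': "open O'" "x \<in> O'"
      then obtain e where e: "0 < e" "ball x e \<subseteq> O'" using openE by blast
      \<comment> \<open>Half of \<open>e\<close>, because a point of the small ball is compared with
        \<open>x\<close> through the centre \<open>a\<close>.\<close>
      obtain n where n: "1 / real (Suc n) < e / 2" using nat_approx_posE[of "e / 2"] e(1) by auto
      obtain a where a: "a \<in> k n" "dist a x < 1 / real (Suc n)" using k(2)[of x n] by auto
      have "ball a (1 / real (Suc n)) \<subseteq> ball x e"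
      proof
        fix y assume "y \<in> ball a (1 / real (Suc n))"
        then have "dist a y < 1 / real (Suc n)" by simp
        then have "dist x y < e" using a(2) n dist_triangle3[of x y a] by linarith
        then show "y \<in> ball x e" by simp
      qed
      then show "\<exists>B'\<in>B. x \<in> B' \<and> B' \<subseteq> O'"
        using a e(2) unfolding B_def by (intro bexI[of _ "ball a (1 / real (Suc n))"]) auto
    qed (auto simp: B_def)
  qed
qed

text \<open>A Lindelof argument: the null members of a countable basis cover \<open>Z\<close>, and
  their union is null. The set \<open>Z\<close> itself may be nonmeasurable.\<close>

lemma AE_not_in_null_opens:
  fixes m :: "'a::topological_space measure"
  assumes B: "countable B" "topological_basis (B :: 'a::topological_space set set)"
    and m: "sets m = sets borel"
    and null: "\<And>z. z \<in> Z \<Longrightarrow> \<exists>U. open U \<and> z \<in> U \<and> emeasure m U = 0"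
  shows "AE z in m. z \<notin> Z"
proof -
  define N where "N = (\<Union>V\<in>{V \<in> B. emeasure m V = 0}. V)"
  have "V \<in> sets m" if "V \<in> B" for V
    using topological_basis_open[OF B(2) that] m by simp
  then have "N \<in> null_sets m"
    unfolding N_def by (intro null_sets_UN') (auto intro: countable_subset[OF _ B(1)])
  moreover have "{z \<in> space m. \<not> z \<notin> Z} \<subseteq> N"
  proof
    fix z assume "z \<in> {z \<in> space m. \<not> z \<notin> Z}"
    then obtain U where U: "open U" "z \<in> U" "emeasure m U = 0" using null by blast
    obtain V where V: "V \<in> B" "z \<in> V" "V \<subseteq> U"
      using topological_basisE[OF B(2) U(1,2)] by blast
    have "emeasure m V \<le> emeasure m U" using U m by (intro emeasure_mono V(3)) simp
    with U V show "z \<in> N" by (auto simp: N_def)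
  qed
  ultimately show ?thesis by (rule AE_I')
qed

text \<open>In a first countable space the complement can be tested with sequences. Passing to a
  subsequence is harmless, since every member of the sequence violates the condition.\<close>

lemma lower_hemicontinuous_open:
  fixes C :: "'w::first_countable_topology \<Rightarrow> 'x::metric_space set"
  assumes lower: "\<And>ws w x. ws \<longlonglongrightarrow> w \<Longrightarrow> x \<in> C w \<Longrightarrow>
        \<exists>r xs. strict_mono r \<and> (\<forall>k. xs k \<in> C (ws (r k))) \<and> xs \<longlonglongrightarrow> x"
    and B: "open B"
  shows "open {w. C w \<inter> B \<noteq> {}}"
proof -
  have "closed {w. C w \<inter> B = {}}"
    unfolding closed_sequential_limits
  proof (intro allI impI)
    fix ws w assume "(\<forall>n. ws n \<in> {w. C w \<inter> B = {}}) \<and> ws \<longlonglongrightarrow> w"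
    then have ws: "\<And>n. C (ws n) \<inter> B = {}" "ws \<longlonglongrightarrow> w" by auto
    show "w \<in> {w. C w \<inter> B = {}}"
    proof (rule ccontr)
      assume "w \<notin> {w. C w \<inter> B = {}}"
      then obtain x where x: "x \<in> C w" "x \<in> B" by blast
      from lower[OF ws(2) x(1)] obtain r :: "nat \<Rightarrow> nat" and xs where
        xs: "\<And>k. xs k \<in> C (ws (r k))" "xs \<longlonglongrightarrow> x" by blast
      from topological_tendstoD[OF xs(2) B x(2)] obtain k where "xs k \<in> B"
        by (auto simp: eventually_sequentially)
      with xs(1)[of k] ws(1)[of "r k"] show False by blast
    qed
  qed
  moreover have "{w. C w \<inter> B \<noteq> {}} = - {w. C w \<inter> B = {}}" by blast
  ultimately show ?thesis by (simp add: open_Compl)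
qed

text \<open>
  The measure \<open>\<mu>' i z y\<close> is the one that results from \<open>\<mu> i\<close> when a player at \<open>z\<close> switches to \<open>y\<close>.
  For \<open>n\<close>-player equilibria it moves one atom; for limit equilibria it is \<open>\<mu> i\<close> itself.
\<close>

lemma limit_equilibrium:
  fixes C :: "'w::{first_countable_topology, metric_space} \<Rightarrow> 'x::metric_space set"
    and F :: "('w \<times> 'x) measure \<Rightarrow> 'w \<Rightarrow> 'x \<Rightarrow> real"
    and \<mu> :: "'i \<Rightarrow> ('w \<times> 'x) measure"
  assumes basis: "countable B" "topological_basis (B :: ('w \<times> 'x) set set)"
    and C_graph_closed: "closed {(w, x). x \<in> C w}"
    and C_lower: "\<And>ws w x. ws \<longlonglongrightarrow> w \<Longrightarrow> x \<in> C w \<Longrightarrow>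
        \<exists>r xs. strict_mono r \<and> (\<forall>k. xs k \<in> C (ws (r k))) \<and> xs \<longlonglongrightarrow> x"
    and F_cont: "continuous_map (prod_topology weak_topology (prod_topology euclidean euclidean))
        euclideanreal (\<lambda>(m, w, x). F m w x)"
    and G: "G \<noteq> bot" and lim: "limitin weak_topology \<mu> m G"
    and lim': "\<And>z y. limitin weak_topology (\<lambda>i. \<mu>' i (z i) (y i)) m G"
    and supp: "\<forall>\<^sub>F i in G. \<forall>U. open U \<longrightarrow> measure (\<mu> i) U > 0 \<longrightarrow>
        (\<exists>z\<in>U. snd z \<in> C (fst z) \<and>
          (\<forall>y\<in>C (fst z). F (\<mu> i) (fst z) (snd z) \<le> F (\<mu>' i z y) (fst z) y))"
  shows "AE z in m. snd z \<in> C (fst z) \<and> (\<forall>y\<in>C (fst z). F m (fst z) (snd z) \<le> F m (fst z) y)"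
proof -
  let ?T = "prod_topology weak_topology (prod_topology euclidean euclidean) ::
    (('w \<times> 'x) measure \<times> 'w \<times> 'x) topology"
  have m: "m \<in> prob_measures" using lim by (simp add: limitin_weak_topology)
  then interpret prob_space m using prob_measuresD by blast
  define Z where "Z = {z. \<not> (snd z \<in> C (fst z) \<and> (\<forall>y\<in>C (fst z). F m (fst z) (snd z) \<le> F m (fst z) y))}"
  have topT: "(m, z) \<in> topspace ?T" for z
    using m by (simp add: topspace_weak_topology)
  \<comment> \<open>Joint continuity of \<open>F\<close> at \<open>(m, z)\<close>, in the form of
    separate neighbourhoods for the measure and for the state.\<close>
  have box: "\<exists>U V. openin weak_topology U \<and> open V \<and> m \<in> U \<and> z \<in> V \<and>
      (\<forall>m'\<in>U. \<forall>z'\<in>V. F m' (fst z') (snd z') \<in> S)"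
    if S: "open S" "F m (fst z) (snd z) \<in> S" for S z
  proof -
    let ?S = "{p \<in> topspace ?T. (\<lambda>(m, w, x). F m w x) p \<in> S}"
    have "openin ?T ?S"
      by (rule openin_continuous_map_preimage[OF F_cont]) (simp add: S)
    from iffD1[OF openin_prod_topology_alt this]
    have nbhd: "(m, z) \<in> ?S \<Longrightarrow> \<exists>U V. openin weak_topology U \<and>
        openin (prod_topology euclidean euclidean) V \<and> m \<in> U \<and> z \<in> V \<and> U \<times> V \<subseteq> ?S"
      by (elim allE impE)
    have "(m, z) \<in> ?S"
      using S(2) topT[of z] by (simp add: case_prod_unfold)
    from nbhd[OF this] obtain U V where UV: "openin weak_topology U"
        "openin (prod_topology euclidean euclidean) V" "m \<in> U" "z \<in> V" "U \<times> V \<subseteq> ?S"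
      by (elim exE conjE)
    have "open V" using UV(2) by (simp add: prod_topology_euclidean)
    moreover have "F m' (fst z') (snd z') \<in> S" if "m' \<in> U" "z' \<in> V" for m' z'
      using subsetD[OF UV(5), of "(m', z')"] that by (simp add: case_prod_unfold)
    ultimately show ?thesis using UV by blast
  qed
  have "\<exists>U. open U \<and> z \<in> U \<and> emeasure m U = 0" if z: "z \<in> Z" for z
  proof (cases "snd z \<in> C (fst z)")
    case False
    \<comment> \<open>The approximating measures cannot charge this open set, because
      \<open>supp\<close> would produce an admissible state inside it.\<close>
    let ?U = "- {(w, x). x \<in> C w}"
    have op: "open ?U" using C_graph_closed by (simp add: open_Compl)
    have "\<not> measure m ?U > 0"
    proof
      assume "measure m ?U > 0"
      from eventually_open_set_pos[OF lim op this] supp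
      have "\<forall>\<^sub>F i in G. False"
        by eventually_elim (use op in fastforce)
      then show False using G by simp
    qed
    then have "emeasure m ?U = 0" by (simp add: emeasure_eq_measure zero_less_measure_iff)
    moreover have "z \<in> ?U" using False by (cases z) simp
    ultimately show ?thesis using op by blast
  next
    case True
    with z obtain y where y: "y \<in> C (fst z)" "F m (fst z) y < F m (fst z) (snd z)"
      by (auto simp: Z_def not_le)
    \<comment> \<open>A level strictly between the two payoffs is a threshold that survives small
      changes of measure, type and action on both sides.\<close>
    then obtain a where a: "F m (fst z) y < a" "a < F m (fst z) (snd z)" using dense by blast
    obtain U1 V1 where 1: "openin weak_topology U1" "open V1" "m \<in> U1" "z \<in> V1"
        "\<And>m' z'. m' \<in> U1 \<Longrightarrow> z' \<in> V1 \<Longrightarrow> F m' (fst z') (snd z') > a"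
      using box[of "{a<..}" z] a by auto
    obtain U2 V2 where 2: "openin weak_topology U2" "open V2" "m \<in> U2" "(fst z, y) \<in> V2"
        "\<And>m' z'. m' \<in> U2 \<Longrightarrow> z' \<in> V2 \<Longrightarrow> F m' (fst z') (snd z') < a"
      using box[of "{..<a}" "(fst z, y)"] a by auto
    obtain P Q where PQ: "open P" "open Q" "fst z \<in> P" "y \<in> Q" "P \<times> Q \<subseteq> V2"
      by (rule open_prod_elim[OF 2(2,4)]) auto
    \<comment> \<open>On \<open>V1\<close> the current payoff stays above \<open>a\<close>; on
      \<open>P \<times> Q\<close> the payoff of a deviation stays below it. Lower hemicontinuity
      makes the types with an admissible action in \<open>Q\<close> an open set.\<close>
    define U where "U = V1 \<inter> (P \<inter> {w. C w \<inter> Q \<noteq> {}}) \<times> UNIV"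
    have "open {w. C w \<inter> Q \<noteq> {}}" by (rule lower_hemicontinuous_open[OF C_lower PQ(2)])
    then have op: "open U" unfolding U_def by (intro open_Int open_Times 1 PQ) auto
    have "\<not> measure m U > 0"
    proof
      assume "measure m U > 0"
      from eventually_open_set_pos[OF lim op this] supp
      have "\<forall>\<^sub>F i in G. \<exists>z y. z \<in> U \<and> y \<in> Q \<and> F (\<mu> i) (fst z) (snd z) \<le> F (\<mu>' i z y) (fst z) y"
      proof eventually_elim
        case (elim i)
        with op obtain z where "z \<in> U"
          and z: "\<forall>y\<in>C (fst z). F (\<mu> i) (fst z) (snd z) \<le> F (\<mu>' i z y) (fst z) y" by blast
        from \<open>z \<in> U\<close> obtain y where "y \<in> C (fst z)" "y \<in> Q" by (auto simp: U_def)
        with \<open>z \<in> U\<close> z show ?case by blast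
      qed
      \<comment> \<open>State and deviation vary with \<open>i\<close> without any control, which is
        why \<open>lim'\<close> is assumed for arbitrary selections.\<close>
      then obtain zs ys where ev: "\<forall>\<^sub>F i in G. zs i \<in> U \<and> ys i \<in> Q \<and>
          F (\<mu> i) (fst (zs i)) (snd (zs i)) \<le> F (\<mu>' i (zs i) (ys i)) (fst (zs i)) (ys i)"
        unfolding eventually_ex by blast
      have "\<forall>\<^sub>F i in G. \<mu> i \<in> U1" by (rule limitinD[OF lim 1(1,3)])
      moreover have "\<forall>\<^sub>F i in G. \<mu>' i (zs i) (ys i) \<in> U2" by (rule limitinD[OF lim' 2(1,3)])
      ultimately have "\<forall>\<^sub>F i in G. False"
        using ev
      proof eventually_elim
        case (elim i)
        then have "zs i \<in> V1" "(fst (zs i), ys i) \<in> V2" using PQ(5) by (auto simp: U_def)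
        with 1(5)[OF elim(1)] 2(5)[OF elim(2)] elim(3) show False by fastforce
      qed
      then show False using G by simp
    qed
    then have "emeasure m U = 0" by (simp add: emeasure_eq_measure zero_less_measure_iff)
    moreover have "z \<in> U" using 1 PQ y by (cases z) (auto simp: U_def)
    ultimately show ?thesis using op by blast
  qed
  then have "AE z in m. z \<notin> Z" by (rule AE_not_in_null_opens[OF basis prob_measuresD(2)[OF m]])
  then show ?thesis by eventually_elim (simp add: Z_def)
qed

section \<open>Equilibria through inequalities, and closedness of equilibrium sets\<close>

lemma eq_INF_iff_le:
  fixes f :: "'a \<Rightarrow> real"
  assumes "a \<in> A" "bdd_below (f ` A)"
  shows "f a = (INF y\<in>A. f y) \<longleftrightarrow> (\<forall>y\<in>A. f a \<le> f y)"
proof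
  assume "f a = (INF y\<in>A. f y)"
  then show "\<forall>y\<in>A. f a \<le> f y" using cINF_lower[OF assms(2)] by simp
next
  assume le: "\<forall>y\<in>A. f a \<le> f y"
  show "f a = (INF y\<in>A. f y)"
    by (rule antisym[OF cINF_greatest cINF_lower[OF assms(2,1)]]) (use le assms(1) in auto)
qed

lemma nash_iff:
  assumes F: "\<forall>m\<in>prob_measures. \<forall>w x. \<bar>F m w x\<bar> \<le> B" and n: "n > 0"
  shows "nash C F n ws xs \<longleftrightarrow> (\<forall>i<n. xs i \<in> C (ws i) \<and> (\<forall>y\<in>C (ws i).
    F (empirical n (\<lambda>k. (ws k, xs k))) (ws i) (xs i)
      \<le> F (empirical n (\<lambda>k. (ws k, (xs(i := y)) k))) (ws i) y))"
proof -
  have "F (empirical n (\<lambda>k. (ws k, xs k))) (ws i) (xs i) =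
      (INF y\<in>C (ws i). F (empirical n (\<lambda>k. (ws k, (xs(i := y)) k))) (ws i) y) \<longleftrightarrow>
      (\<forall>y\<in>C (ws i). F (empirical n (\<lambda>k. (ws k, xs k))) (ws i) (xs i)
        \<le> F (empirical n (\<lambda>k. (ws k, (xs(i := y)) k))) (ws i) y)"
    if "xs i \<in> C (ws i)" for i
  proof -
    let ?f = "\<lambda>y. F (empirical n (\<lambda>k. (ws k, (xs(i := y)) k))) (ws i) y"
    have "- B \<le> ?f y" for y
      using F[rule_format, OF prob_measures_empirical[OF n], of "\<lambda>k. (ws k, (xs(i := y)) k)" "ws i" y] by linarith
    then have "bdd_below (?f ` C (ws i))" by (intro bdd_belowI2)
    \<comment> \<open>Updating a profile with the player's own action changes nothing, so the
      equilibrium payoff is itself one of the values in the infimum.\<close>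
    from eq_INF_iff_le[OF that this] show ?thesis by (simp only: fun_upd_triv)
  qed
  then show ?thesis unfolding nash_def by blast
qed

lemma mfe_set_iff:
  assumes F: "\<forall>m\<in>prob_measures. \<forall>w x. \<bar>F m w x\<bar> \<le> B"
  shows "m \<in> mfe_set C F lam \<longleftrightarrow> m \<in> prob_measures \<and> distr m borel fst = lam \<and>
    (AE z in m. snd z \<in> C (fst z) \<and> (\<forall>y\<in>C (fst z). F m (fst z) (snd z) \<le> F m (fst z) y))"
proof (cases "m \<in> prob_measures")
  case True
  have "F m (fst z) (snd z) = (INF y\<in>C (fst z). F m (fst z) y) \<longleftrightarrow>
      (\<forall>y\<in>C (fst z). F m (fst z) (snd z) \<le> F m (fst z) y)" if "snd z \<in> C (fst z)" for z
  proof -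
    have "- B \<le> F m (fst z) y" for y
      using F[rule_format, OF True, of "fst z" y] by linarith
    then have "bdd_below (F m (fst z) ` C (fst z))" by (intro bdd_belowI2)
    from eq_INF_iff_le[OF that this] show ?thesis .
  qed
  then have "(\<lambda>z. snd z \<in> C (fst z) \<and> F m (fst z) (snd z) = (INF y\<in>C (fst z). F m (fst z) y)) =
      (\<lambda>z. snd z \<in> C (fst z) \<and> (\<forall>y\<in>C (fst z). F m (fst z) (snd z) \<le> F m (fst z) y))"
    by (intro ext conj_cong refl)
  then show ?thesis unfolding mfe_set_def mem_Collect_eq by (simp only:)
qed (simp add: mfe_set_def)

lemma continuous_map_weak_topologyI:
  fixes \<phi> :: "'b::topological_space \<Rightarrow> 'a::topological_space measure"
  assumes "\<And>x. \<phi> x \<in> prob_measures"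
    and "\<And>f. f \<in> bcf \<Longrightarrow> continuous_on UNIV (\<lambda>x. integral\<^sup>L (\<phi> x) f)"
  shows "continuous_map euclidean weak_topology \<phi>"
  unfolding weak_topology_def
proof (rule continuous_on_generated_topo)
  fix A :: "'a measure set" assume "A \<in> {{m \<in> prob_measures. integral\<^sup>L m f \<in> U} |(f :: 'a \<Rightarrow> real) U.
        continuous_on UNIV f \<and> bounded (range f) \<and> open U}"
  then obtain f :: "'a \<Rightarrow> real" and U where A: "A = {m \<in> prob_measures. integral\<^sup>L m f \<in> U}" "open U"
    and "continuous_on UNIV f \<and> bounded (range f)" by blast
  then have "f \<in> bcf" by (simp add: bcf_def)
  then have "open ((\<lambda>x. integral\<^sup>L (\<phi> x) f) -` U)" by (intro open_vimage A(2) assms(2))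
  moreover have "\<phi> -` A \<inter> topspace euclidean = (\<lambda>x. integral\<^sup>L (\<phi> x) f) -` U"
    using assms(1) by (auto simp: A(1))
  ultimately show "openin euclidean (\<phi> -` A \<inter> topspace euclidean)" by simp
next
  show "\<phi> ` topspace euclidean \<subseteq> \<Union>{{m \<in> prob_measures. integral\<^sup>L m f \<in> U} |(f :: 'a \<Rightarrow> real) U.
        continuous_on UNIV f \<and> bounded (range f) \<and> open U}"
    unfolding topology_generated_by_topspace[symmetric] weak_topology_def[symmetric]
      topspace_weak_topology using assms(1) by blast
qed

lemma continuous_map_empirical:
  fixes z :: "'b::topological_space \<Rightarrow> nat \<Rightarrow> 'a::topological_space"
  assumes n: "n > 0" and z: "\<And>k. continuous_on UNIV (\<lambda>x. z x k)"
  shows "continuous_map euclidean weak_topology (\<lambda>x. empirical n (z x))"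
proof (rule continuous_map_weak_topologyI)
  fix f :: "'a \<Rightarrow> real" assume f: "f \<in> bcf"
  have "continuous_on UNIV (\<lambda>x. f (z x k))" for k
    using bcf_def f by (intro continuous_on_compose2[OF _ z]) auto
  then show "continuous_on UNIV (\<lambda>x. integral\<^sup>L (empirical n (z x)) f)"
    using n by (simp add: integral_empirical_bcf f) (intro continuous_intros; simp)
qed (rule prob_measures_empirical[OF n])

text \<open>Equilibrium profiles form a closed subset of a compact product, and the empirical
  measure depends continuously on the profile. Its image is thus compact, hence closed in the
  Hausdorff weak topology.\<close>

lemma closedin_nash_set:
  fixes C :: "'w::metric_space \<Rightarrow> 'x::metric_space set"
  assumes X: "compact (UNIV :: 'x set)" and C: "\<And>w. closed (C w)"
    and F: "\<forall>m\<in>prob_measures. \<forall>w x. \<bar>F m w x\<bar> \<le> B"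
    and F_cont: "continuous_map (prod_topology weak_topology (prod_topology euclidean euclidean))
        euclideanreal (\<lambda>(m, w, x). F m w x)"
    and n: "n > 0"
  shows "closedin weak_topology (nash_set C F n ws)"
proof -
  have "compactin (product_topology (\<lambda>_::nat. euclidean) UNIV) (\<Pi>\<^sub>E _\<in>UNIV. (UNIV :: 'x set))"
    unfolding compactin_PiE by (simp add: compactin_euclidean_iff X)
  then have cpt: "compact (UNIV :: (nat \<Rightarrow> 'x) set)"
    by (simp add: euclidean_product_topology compactin_euclidean_iff)
  have coord: "continuous_on UNIV (\<lambda>xs :: nat \<Rightarrow> 'x. xs k)" for k
    by (rule continuous_on_product_coordinates)
  have upd: "continuous_on UNIV (\<lambda>xs :: nat \<Rightarrow> 'x. (xs(i := y)) k)" for i y k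
    by (cases "k = i") (auto intro: coord)
  have Fc: "continuous_on UNIV (\<lambda>xs :: nat \<Rightarrow> 'x. F (empirical n (\<lambda>k. (ws k, p xs k))) w (q xs))"
    if p: "\<And>k. continuous_on UNIV (\<lambda>xs. p xs k)" and q: "continuous_on UNIV q" for p q w
  proof -
    have 1: "continuous_map euclidean weak_topology (\<lambda>xs :: nat \<Rightarrow> 'x. empirical n (\<lambda>k. (ws k, p xs k)))"
      by (intro continuous_map_empirical n continuous_on_Pair continuous_on_const p)
    have "continuous_map euclidean (prod_topology weak_topology (prod_topology euclidean euclidean))
        (\<lambda>xs :: nat \<Rightarrow> 'x. (empirical n (\<lambda>k. (ws k, p xs k)), w, q xs))"
      by (intro continuous_map_pairedI 1) (auto simp: q)
    from continuous_map_compose[OF this F_cont] show ?thesis by (simp add: o_def)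
  qed
  let ?S = "{xs. nash C F n ws xs}"
  \<comment> \<open>For each fixed deviation the inequality is closed in the profile; intersecting
    over deviations avoids any continuity of the infimum.\<close>
  have "closed (\<Inter>i\<in>{..<n}. ((\<lambda>xs. xs i) -` C (ws i)) \<inter> (\<Inter>y\<in>C (ws i). {xs.
      F (empirical n (\<lambda>k. (ws k, xs k))) (ws i) (xs i)
        \<le> F (empirical n (\<lambda>k. (ws k, (xs(i := y)) k))) (ws i) y}))"
    by (intro closed_INT ballI closed_Int closed_vimage C coord closed_Collect_le Fc upd continuous_on_const)
  also have "\<dots> = ?S"
    unfolding nash_iff[OF F n] by (auto simp del: fun_upd_apply)
  finally have "compact ?S" using compact_Int_closed[OF cpt] by simp
  then have "compactin euclidean ?S" by (simp add: compactin_euclidean_iff)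
  moreover have "continuous_map euclidean weak_topology (\<lambda>xs :: nat \<Rightarrow> 'x. empirical n (\<lambda>k. (ws k, xs k)))"
    by (intro continuous_map_empirical n continuous_on_Pair continuous_on_const coord)
  ultimately have "compactin weak_topology ((\<lambda>xs. empirical n (\<lambda>k. (ws k, xs k))) ` ?S)"
    by (rule image_compactin)
  moreover have "(\<lambda>xs. empirical n (\<lambda>k. (ws k, xs k))) ` ?S = nash_set C F n ws"
    by (auto simp: nash_set_def)
  ultimately show ?thesis using compactin_imp_closedin[OF Hausdorff_weak_topology] by simp
qed

lemma fst_marginal:
  fixes m :: "('a::topological_space \<times> 'b::topological_space) measure" and g :: "'a \<Rightarrow> real"
  assumes m: "m \<in> prob_measures"
  shows "distr m borel fst \<in> prob_measures"
    and "g \<in> borel_measurable borel \<Longrightarrow> integral\<^sup>L (distr m borel fst) g = (\<integral>z. g (fst z) \<partial>m)"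
proof -
  have "fst \<in> borel_measurable (borel :: ('a \<times> 'b) measure)"
    by (intro borel_measurable_continuous_onI continuous_on_fst continuous_on_id)
  then have fst: "fst \<in> measurable m borel"
    using measurable_cong_sets[OF prob_measuresD(2)[OF m] refl] by blast
  then show "distr m borel fst \<in> prob_measures"
    using prob_space.prob_space_distr[OF prob_measuresD(1)[OF m]] by (auto simp: prob_measures_def)
  show "integral\<^sup>L (distr m borel fst) g = (\<integral>z. g (fst z) \<partial>m)" if "g \<in> borel_measurable borel"
    by (rule integral_distr[OF fst that])
qed

lemma bcf_fst: "g \<in> bcf \<Longrightarrow> (\<lambda>z. g (fst z)) \<in> bcf"
  by (rule bcf_comp[where g=fst]) (auto intro: continuous_on_fst continuous_on_id)

text \<open>A filter of limit equilibria converging to \<open>m\<close> is an instance of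
  \<open>limit_equilibrium\<close> in which the measures serve as their own indices. The marginal is
  constant along the filter and is preserved by testing with functions of the type alone.\<close>

lemma closedin_mfe_set:
  fixes C :: "'w::metric_space \<Rightarrow> 'x::metric_space set"
    and F :: "('w \<times> 'x) measure \<Rightarrow> 'w \<Rightarrow> 'x \<Rightarrow> real"
  assumes basis: "countable B" "topological_basis (B :: ('w \<times> 'x) set set)"
    and C_graph_closed: "closed {(w, x). x \<in> C w}"
    and C_lower: "\<And>ws w x. ws \<longlonglongrightarrow> w \<Longrightarrow> x \<in> C w \<Longrightarrow>
        \<exists>r xs. strict_mono r \<and> (\<forall>k. xs k \<in> C (ws (r k))) \<and> xs \<longlonglongrightarrow> x"
    and F: "\<forall>m\<in>prob_measures. \<forall>w x. \<bar>F m w x\<bar> \<le> D"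
    and F_cont: "continuous_map (prod_topology weak_topology (prod_topology euclidean euclidean))
        euclideanreal (\<lambda>(m, w, x). F m w x)"
    and lam: "lam \<in> prob_measures"
  shows "closedin weak_topology (mfe_set C F lam)"
proof (rule closedin_limitinI)
  show "mfe_set C F lam \<subseteq> topspace weak_topology"
    by (auto simp: topspace_weak_topology mfe_set_def)
next
  fix G and m :: "('w \<times> 'x) measure"
  assume G: "G \<noteq> bot" and lim: "limitin weak_topology (\<lambda>x. x) m G"
    and ev: "\<forall>\<^sub>F x in G. x \<in> mfe_set C F lam"
  have m: "m \<in> prob_measures" using lim by (simp add: limitin_weak_topology)
  have "distr m borel fst = lam"
  proof (rule prob_measures_eqI[OF fst_marginal(1)[OF m] lam])
    fix g :: "'w \<Rightarrow> real" assume g: "g \<in> bcf"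
    have gm: "g \<in> borel_measurable borel" by (rule measurable_bcf[OF g refl])
    have "\<forall>\<^sub>F x in G. integral\<^sup>L lam g = (\<integral>z. g (fst z) \<partial>x)"
      using ev by eventually_elim (use fst_marginal(2)[OF _ gm] in \<open>auto simp: mfe_set_def\<close>)
    moreover have "((\<lambda>x. \<integral>z. g (fst z) \<partial>x) \<longlongrightarrow> (\<integral>z. g (fst z) \<partial>m)) G"
      using lim bcf_fst[OF g] unfolding limitin_weak_topology by blast
    ultimately have "((\<lambda>x. integral\<^sup>L lam g) \<longlongrightarrow> (\<integral>z. g (fst z) \<partial>m)) G"
      by (subst tendsto_cong)
    then have "integral\<^sup>L lam g = (\<integral>z. g (fst z) \<partial>m)"
      by (rule tendsto_unique[OF G tendsto_const])
    then show "integral\<^sup>L (distr m borel fst) g = integral\<^sup>L lam g"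
      by (simp add: fst_marginal(2)[OF m gm])
  qed
  moreover have "AE z in m. snd z \<in> C (fst z) \<and> (\<forall>y\<in>C (fst z). F m (fst z) (snd z) \<le> F m (fst z) y)"
  proof (rule limit_equilibrium[where \<mu>'="\<lambda>i _ _. i", OF basis C_graph_closed C_lower F_cont G lim lim])
    show "\<forall>\<^sub>F i in G. \<forall>U. open U \<longrightarrow> measure i U > 0 \<longrightarrow>
        (\<exists>z\<in>U. snd z \<in> C (fst z) \<and> (\<forall>y\<in>C (fst z). F i (fst z) (snd z) \<le> F i (fst z) y))"
      using ev
    proof eventually_elim
      case (elim i)
      then have i: "i \<in> prob_measures"
        and AE: "AE z in i. snd z \<in> C (fst z) \<and> (\<forall>y\<in>C (fst z). F i (fst z) (snd z) \<le> F i (fst z) y)"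
        unfolding mfe_set_iff[OF F] by auto
      show ?case
      proof (intro allI impI)
        fix U :: "('w \<times> 'x) set" assume U: "open U" "measure i U > 0"
        show "\<exists>z\<in>U. snd z \<in> C (fst z) \<and> (\<forall>y\<in>C (fst z). F i (fst z) (snd z) \<le> F i (fst z) y)"
        proof (rule ccontr)
          assume no: "\<not> ?thesis"
          have "AE z in i. z \<notin> U" using AE by eventually_elim (use no in blast)
          moreover have "U \<in> sets i" using U(1) i by (simp add: prob_measuresD)
          ultimately have "emeasure i U = 0"
            using AE_iff_measurable[of U i "\<lambda>z. z \<notin> U"] sets.sets_into_space by fastforce
          with U(2) show False by (simp add: measure_def)
        qed
      qed
    qed
  qed
  ultimately show "m \<in> mfe_set C F lam" using m by (simp add: mfe_set_iff[OF F])
qed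

text \<open>The deterministic core, for a single type sequence \<open>ws\<close>:
  \<open>conv\<close> and \<open>tight\<close> are the two properties that hold almost surely, and
  neither mentions \<open>E\<close>.\<close>

lemma nash_sets_eventually_subset:
  fixes C :: "'w::metric_space \<Rightarrow> 'x::metric_space set"
    and F :: "('w \<times> 'x) measure \<Rightarrow> 'w \<Rightarrow> 'x \<Rightarrow> real"
  assumes basis: "countable B" "topological_basis (B :: ('w \<times> 'x) set set)"
    and X: "compact (UNIV :: 'x set)"
    and C_graph_closed: "closed {(w, x). x \<in> C w}"
    and C_lower: "\<And>ws w x. ws \<longlonglongrightarrow> w \<Longrightarrow> x \<in> C w \<Longrightarrow>
        \<exists>r xs. strict_mono r \<and> (\<forall>k. xs k \<in> C (ws (r k))) \<and> xs \<longlonglongrightarrow> x"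
    and F: "\<forall>m\<in>prob_measures. \<forall>w x. \<bar>F m w x\<bar> \<le> D"
    and F_cont: "continuous_map (prod_topology weak_topology (prod_topology euclidean euclidean))
        euclideanreal (\<lambda>(m, w, x). F m w x)"
    and lam: "lam \<in> prob_measures"
    and gen: "Int_stable A" "sets borel = sigma_sets UNIV A" "\<And>U. U \<in> A \<Longrightarrow> open U"
    and conv: "\<And>U k. U \<in> A \<Longrightarrow>
        (\<lambda>n. (\<Sum>i<n. bump U k (ws i)) / real n) \<longlonglongrightarrow> integral\<^sup>L lam (bump U k)"
    and tight: "\<And>e. 0 < e \<Longrightarrow> \<exists>K. compact K \<and>
        (\<forall>\<^sub>F n in sequentially. (\<Sum>i<n. indicator (- K) (ws i)) / real n < e)"
    and E: "openin weak_topology E" "mfe_set C F lam \<subseteq> E"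
  shows "\<forall>\<^sub>F n in sequentially. nash_set C F n ws \<subseteq> E"
proof (rule ccontr)
  assume not: "\<not> ?thesis"
  define Bad where "Bad = {n. \<not> nash_set C F n ws \<subseteq> E}"
  \<comment> \<open>This filter is proper exactly because failures occur for arbitrarily large
    \<open>n\<close>; it takes the place of a subsequence of bad indices.\<close>
  define H where "H = inf sequentially (principal Bad)"
  have H: "H \<noteq> bot"
    using not eventually_inf_principal[of "\<lambda>_. False" sequentially Bad]
    by (auto simp: H_def Bad_def trivial_limit_def)
  have Hseq: "H \<le> sequentially" by (simp add: H_def)
  have HBad: "\<forall>\<^sub>F n in H. n \<in> Bad" by (simp add: H_def eventually_inf_principal)
  have "\<exists>xs. n \<in> Bad \<longrightarrow> nash C F n ws xs \<and> empirical n (\<lambda>k. (ws k, xs k)) \<notin> E" for n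
    by (auto simp: Bad_def nash_set_def)
  then obtain xs where xs: "\<And>n. n \<in> Bad \<Longrightarrow> nash C F n ws (xs n)"
      "\<And>n. n \<in> Bad \<Longrightarrow> empirical n (\<lambda>k. (ws k, xs n k)) \<notin> E" by metis
  define \<mu> where "\<mu> n = empirical n (\<lambda>k. (ws k, xs n k))" for n
  have P: "\<forall>\<^sub>F n in H. \<mu> n \<in> prob_measures"
    using filter_leD[OF Hseq eventually_gt_at_top[of 0]]
    by eventually_elim (simp add: \<mu>_def prob_measures_empirical)
  obtain G m where G: "G \<noteq> bot" "G \<le> H" and lim: "limitin weak_topology \<mu> m G"
  proof (rule Prokhorov_cluster[OF H P])
    fix e :: real assume "0 < e"
    then obtain K where K: "compact K"
      "\<forall>\<^sub>F n in sequentially. (\<Sum>i<n. indicator (- K) (ws i)) / real n < e" using tight by blast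
    \<comment> \<open>Compactness of the action space makes a condition on the types alone
      sufficient for tightness of the joint measures.\<close>
    have KX: "compact (K \<times> (UNIV :: 'x set))" by (rule compact_Times[OF K(1) X])
    have "\<forall>\<^sub>F n in H. measure (\<mu> n) (- (K \<times> UNIV)) < e"
      using filter_leD[OF Hseq K(2)] filter_leD[OF Hseq eventually_gt_at_top[of 0]]
    proof eventually_elim
      case (elim n)
      have "- (K \<times> (UNIV :: 'x set)) \<in> sets borel"
        using compact_imp_closed[OF KX] by (intro borel_open open_Compl)
      then have "measure (\<mu> n) (- (K \<times> UNIV)) =
          (\<Sum>k<n. indicator (- (K \<times> UNIV)) (ws k, xs n k)) / real n"
        unfolding \<mu>_def by (rule measure_empirical[OF elim(2)])
      also have "\<dots> = (\<Sum>k<n. indicator (- K) (ws k)) / real n" by (simp add: indicator_def)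
      finally show ?case using elim(1) by simp
    qed
    with KX show "\<exists>K. compact K \<and> (\<forall>\<^sub>F i in H. measure (\<mu> i) (- K) < e)" by blast
  qed blast
  have Gseq: "G \<le> sequentially" using G(2) Hseq by (rule order_trans)
  have G0: "\<forall>\<^sub>F n in G. n > 0" using Gseq eventually_gt_at_top by (rule filter_leD)
  have GBad: "\<forall>\<^sub>F n in G. n \<in> Bad" using G(2) HBad by (rule filter_leD)
  have m: "m \<in> prob_measures" using lim by (simp add: limitin_weak_topology)
  have "distr m borel fst = lam"
  proof (rule prob_measures_eqI_generator[OF fst_marginal(1)[OF m] lam gen])
    fix U k assume U: "U \<in> A"
    have "\<forall>\<^sub>F n in G. (\<integral>z. bump U k (fst z) \<partial>\<mu> n) = (\<Sum>i<n. bump U k (ws i)) / real n"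
      using G0 by eventually_elim (simp add: \<mu>_def integral_empirical_bcf bcf_fst bump_bcf)
    moreover have "((\<lambda>n. \<integral>z. bump U k (fst z) \<partial>\<mu> n) \<longlongrightarrow> (\<integral>z. bump U k (fst z) \<partial>m)) G"
      using lim bcf_fst[OF bump_bcf] unfolding limitin_weak_topology by blast
    ultimately have "((\<lambda>n. (\<Sum>i<n. bump U k (ws i)) / real n) \<longlongrightarrow> (\<integral>z. bump U k (fst z) \<partial>m)) G"
      by (rule Lim_transform_eventually[rotated])
    moreover have "((\<lambda>n. (\<Sum>i<n. bump U k (ws i)) / real n) \<longlongrightarrow> integral\<^sup>L lam (bump U k)) G"
      by (rule filterlim_mono[OF conv[OF U] order_refl Gseq])
    ultimately have "(\<integral>z. bump U k (fst z) \<partial>m) = integral\<^sup>L lam (bump U k)"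
      by (rule tendsto_unique[OF G(1)])
    then show "integral\<^sup>L (distr m borel fst) (bump U k) = integral\<^sup>L lam (bump U k)"
      by (simp add: fst_marginal(2)[OF m] measurable_bcf[OF bump_bcf])
  qed
  moreover have "AE z in m. snd z \<in> C (fst z) \<and> (\<forall>y\<in>C (fst z). F m (fst z) (snd z) \<le> F m (fst z) y)"
  proof -
    \<comment> \<open>Deviations in \<open>limit_equilibrium\<close> are attached to states, so a
      player sitting at \<open>z\<close> has to be chosen. If there is none the index is arbitrary,
      which is harmless: changing any single index keeps the weak limit.\<close>
    define j where "j n z = (SOME k. k < n \<and> (ws k, xs n k) = z)" for n z
    define \<mu>' where "\<mu>' n z y = empirical n (\<lambda>k. (ws k, ((xs n)(j n z := y)) k))" for n z y
    show ?thesis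
    proof (rule limit_equilibrium[where \<mu>'=\<mu>', OF basis C_graph_closed C_lower F_cont G(1) lim])
      fix z y
      show "limitin weak_topology (\<lambda>n. \<mu>' n (z n) (y n)) m G"
        unfolding \<mu>'_def
        by (rule limitin_empirical_change_one[OF lim[unfolded \<mu>_def], where k="\<lambda>n. j n (z n)"])
           (use Gseq in \<open>auto simp: filterlim_def filtermap_ident\<close>)
    next
      show "\<forall>\<^sub>F n in G. \<forall>U. open U \<longrightarrow> measure (\<mu> n) U > 0 \<longrightarrow>
        (\<exists>z\<in>U. snd z \<in> C (fst z) \<and>
          (\<forall>y\<in>C (fst z). F (\<mu> n) (fst z) (snd z) \<le> F (\<mu>' n z y) (fst z) y))"
        using G0 GBad
      proof eventually_elim
        case (elim n)
        show ?case
        proof (intro allI impI)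
          fix U :: "('w \<times> 'x) set" assume U: "open U" "measure (\<mu> n) U > 0"
          then obtain k where k: "k < n" "(ws k, xs n k) \<in> U"
            using measure_empirical_pos[OF elim(1), of U] by (auto simp: \<mu>_def)
          define z where "z = (ws k, xs n k)"
          have j: "j n z < n \<and> (ws (j n z), xs n (j n z)) = z"
            unfolding j_def by (rule someI[of _ k]) (simp add: k z_def)
          have jz: "j n z < n" "ws (j n z) = fst z" "xs n (j n z) = snd z"
            by (rule conjunct1[OF j] arg_cong[OF conjunct2[OF j], of fst, unfolded fst_conv]
                arg_cong[OF conjunct2[OF j], of snd, unfolded snd_conv])+
          have "snd z \<in> C (fst z) \<and>
              (\<forall>y\<in>C (fst z). F (\<mu> n) (fst z) (snd z) \<le> F (\<mu>' n z y) (fst z) y)"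
            using xs(1)[OF elim(2)] jz(1)
            unfolding nash_iff[OF F elim(1)] \<mu>_def \<mu>'_def jz(2,3)[symmetric] by blast
          with k(2) show "\<exists>z\<in>U. snd z \<in> C (fst z) \<and>
              (\<forall>y\<in>C (fst z). F (\<mu> n) (fst z) (snd z) \<le> F (\<mu>' n z y) (fst z) y)"
            unfolding z_def by blast
        qed
      qed
    qed
  qed
  ultimately have "m \<in> mfe_set C F lam" using m by (simp add: mfe_set_iff[OF F])
  then have "m \<in> E" using E(2) by blast
  from limitinD[OF lim E(1) this] GBad have "\<forall>\<^sub>F n in G. False"
    by eventually_elim (use xs(2) in \<open>auto simp: \<mu>_def\<close>)
  then show False using G(1) by simp
qed

section \<open>Countable test families and the almost sure conclusion\<close>

lemma countable_Int_stable_generator: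
  obtains A :: "'a::second_countable_topology set set" where
    "countable A" "Int_stable A" "sets borel = sigma_sets UNIV A" "\<And>U. U \<in> A \<Longrightarrow> open U"
proof -
  obtain B :: "'a set set" where B: "countable B" "topological_basis B"
    using ex_countable_basis by blast
  \<comment> \<open>Closing a countable basis under finite intersections keeps it countable; the
    empty family contributes \<open>UNIV\<close>, which is open.\<close>
  define A where "A = Inter ` {S. finite S \<and> S \<subseteq> B}"
  have cA: "countable A" unfolding A_def
    by (intro countable_image countable_Collect_finite_subset B(1))
  have oA: "open U" if "U \<in> A" for U
    using that topological_basis_open[OF B(2)] by (auto simp: A_def)
  have BA: "B \<subseteq> A"
  proof
    fix b assume "b \<in> B"
    then show "b \<in> A" unfolding A_def by (intro image_eqI[of _ _ "{b}"]) auto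
  qed
  have "topological_basis A"
  proof (rule topological_basisI)
    fix O' and x :: 'a assume "open O'" "x \<in> O'"
    then obtain B' where "B' \<in> B" "x \<in> B'" "B' \<subseteq> O'" by (rule topological_basisE[OF B(2)])
    with BA show "\<exists>B'\<in>A. x \<in> B' \<and> B' \<subseteq> O'" by blast
  qed (rule oA)
  from borel_eq_countable_basis[OF cA this] have "sets borel = sets (sigma UNIV A)" by simp
  then have "sets borel = sigma_sets UNIV A" by (simp only: sets_measure_of subset_UNIV Pow_UNIV)
  moreover have "Int_stable A"
    unfolding Int_stable_def A_def
  proof (clarify)
    fix S S' assume "finite S" "S \<subseteq> B" "finite S'" "S' \<subseteq> B"
    then show "\<Inter>S \<inter> \<Inter>S' \<in> Inter ` {S. finite S \<and> S \<subseteq> B}"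
      by (intro image_eqI[of _ _ "S \<union> S'"]) auto
  qed
  ultimately show ?thesis using that cA oA by blast
qed

text \<open>Ulam's theorem: inner regularity makes a single law on a Polish space tight.\<close>

lemma compact_complement_small:
  fixes lam :: "'w::polish_space measure"
  assumes "lam \<in> prob_measures" "0 < e"
  shows "\<exists>K. compact K \<and> measure lam (- K) < e"
proof -
  interpret prob_space lam using prob_measuresD[OF assms(1)] by simp
  have sp: "space lam = UNIV" and se: "sets lam = sets borel" using assms(1) by (simp_all add: prob_measuresD)
  have "ennreal (1 - e) < emeasure lam UNIV"
    using assms(2) emeasure_space_1 by (simp add: sp ennreal_less_one_iff)
  also have "\<dots> = (SUP K\<in>{K. K \<subseteq> UNIV \<and> compact K}. emeasure lam K)"
    by (rule inner_regular) (simp_all add: se)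
  finally obtain K where K: "compact K" "ennreal (1 - e) < emeasure lam K"
    unfolding less_SUP_iff by auto
  have "1 - e < measure lam K"
    using K(2) unfolding emeasure_eq_measure by (meson ennreal_leI not_le)
  moreover have "measure lam (- K) = 1 - measure lam K"
    using prob_compl[of K] K(1) by (simp add: sp se Compl_eq_Diff_UNIV borel_compact)
  ultimately show ?thesis using K(1) by (intro exI[of _ K]) simp
qed

theorem theorem2p6:
  fixes C :: "'w::polish_space \<Rightarrow> 'x::metric_space set"
    and F :: "('w \<times> 'x) measure \<Rightarrow> 'w \<Rightarrow> 'x \<Rightarrow> real"
    and Pr :: "'o measure"
    and W :: "nat \<Rightarrow> 'o \<Rightarrow> 'w"
    and lam0 :: "'w measure"
  assumes X_compact: "compact (UNIV :: 'x set)"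
    and C_nonempty: "\<And>w. C w \<noteq> {}"
    and C_closed: "\<And>w. closed (C w)"
    and C_graph_closed: "closed {(w, x). x \<in> C w}"
    and C_lower: "\<And>ws w x. ws \<longlonglongrightarrow> w \<Longrightarrow> x \<in> C w \<Longrightarrow>
        \<exists>r xs. strict_mono r \<and> (\<forall>k. xs k \<in> C (ws (r k))) \<and> xs \<longlonglongrightarrow> x"
    and F_bounded: "\<exists>B. \<forall>m\<in>prob_measures. \<forall>w x. \<bar>F m w x\<bar> \<le> B"
    and F_cont: "continuous_map (prod_topology weak_topology (prod_topology euclidean euclidean))
        euclideanreal (\<lambda>(m, w, x). F m w x)"
    and nash_exists: "\<And>n ws. \<exists>xs. nash C F n ws xs"
    and Pr: "prob_space Pr"
    and lam0: "prob_space lam0" "sets lam0 = sets borel"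
    and W_meas: "\<And>i. W i \<in> measurable Pr borel"
    and W_indep: "prob_space.indep_vars Pr (\<lambda>_. borel) W UNIV"
    and W_law: "\<And>i. distr Pr borel (W i) = lam0"
  shows "AE \<omega> in Pr. limitin (upper_vietoris weak_topology)
            (\<lambda>n. nash_set C F n (\<lambda>k. W k \<omega>)) (mfe_set C F lam0) sequentially"
proof -
  obtain D where F: "\<forall>m\<in>prob_measures. \<forall>w x. \<bar>F m w x\<bar> \<le> D" using F_bounded by blast
  have lam: "lam0 \<in> prob_measures" using lam0 by (simp add: prob_measures_def)
  obtain Bx :: "'x set set" where Bx: "countable Bx" "topological_basis Bx"
    by (rule compact_countable_basis[OF X_compact])
  obtain Bw :: "'w set set" where Bw: "countable Bw" "topological_basis Bw"
    using ex_countable_basis by blast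
  define B where "B = (\<lambda>(a, b). a \<times> b) ` (Bw \<times> Bx)"
  have basis: "countable B" "topological_basis B"
    unfolding B_def by (auto intro!: topological_basis_prod Bw Bx countable_image countable_SIGMA)
  obtain A :: "'w set set" where A: "countable A" "Int_stable A" "sets borel = sigma_sets UNIV A"
      "\<And>U. U \<in> A \<Longrightarrow> open U"
    using countable_Int_stable_generator by blast
  have "\<forall>j::nat. \<exists>K. compact K \<and> measure lam0 (- K) < 1 / real (Suc j)"
    by (intro allI compact_complement_small[OF lam]) simp
  from choice[OF this] obtain K
    where K: "\<And>j. compact (K j)" "\<And>j::nat. measure lam0 (- K j) < 1 / real (Suc j)" by blast
  have K_meas: "- K j \<in> sets lam0" for j
    using compact_imp_closed[OF K(1)[of j]] by (simp add: lam0(2) open_Compl)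
  \<comment> \<open>Both almost sure statements are countable conjunctions whose exceptional sets
    are fixed before any open set \<open>E\<close> enters.\<close>
  have "AE \<omega> in Pr. \<forall>U\<in>A. \<forall>k. (\<lambda>n. (\<Sum>i<n. bump U k (W i \<omega>)) / real n) \<longlonglongrightarrow> integral\<^sup>L lam0 (bump U k)"
    unfolding AE_ball_countable[OF A(1)] AE_all_countable
  proof (intro ballI allI)
    fix U :: "'w set" and k
    show "AE \<omega> in Pr. (\<lambda>n. (\<Sum>i<n. bump U k (W i \<omega>)) / real n) \<longlonglongrightarrow> integral\<^sup>L lam0 (bump U k)"
      by (rule AE_average_function[OF Pr W_indep W_meas W_law measurable_bcf[OF bump_bcf refl], where B=1])
         (simp add: bump_bounds(1,2))
  qed
  moreover have "AE \<omega> in Pr. \<forall>j. (\<lambda>n. (\<Sum>i<n. indicator (- K j) (W i \<omega>)) / real n) \<longlonglongrightarrow> measure lam0 (- K j)"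
    unfolding AE_all_countable
  proof
    fix j
    have "AE \<omega> in Pr. (\<lambda>n. (\<Sum>i<n. indicator (- K j) (W i \<omega>)) / real n) \<longlonglongrightarrow> integral\<^sup>L lam0 (indicator (- K j))"
    proof (rule AE_average_function[OF Pr W_indep W_meas W_law, where B=1])
      show "indicator (- K j) \<in> borel_measurable (borel :: 'w measure)"
        using K_meas[of j] by (intro borel_measurable_indicator) (simp only: lam0(2))
    qed simp
    then show "AE \<omega> in Pr. (\<lambda>n. (\<Sum>i<n. indicator (- K j) (W i \<omega>)) / real n) \<longlonglongrightarrow> measure lam0 (- K j)"
      using K_meas[of j] by simp
  qed
  ultimately show ?thesis
  proof eventually_elim
    case (elim \<omega>)
    have sub: "\<forall>\<^sub>F n in sequentially. nash_set C F n (\<lambda>k. W k \<omega>) \<subseteq> E"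
      if E: "openin weak_topology E" "mfe_set C F lam0 \<subseteq> E" for E
    proof (rule nash_sets_eventually_subset[OF basis X_compact C_graph_closed C_lower F F_cont lam A(2-4) _ _ E])
      show "(\<lambda>n. (\<Sum>i<n. bump U k (W i \<omega>)) / real n) \<longlonglongrightarrow> integral\<^sup>L lam0 (bump U k)" if "U \<in> A" for U k
        using elim(1) that by blast
      fix e :: real assume "0 < e"
      then obtain j where "1 / real (Suc j) < e" using nat_approx_posE by blast
      then have "measure lam0 (- K j) < e" using K(2)[of j] by linarith
      with order_tendstoD(2)[OF elim(2)[rule_format, of j]] K(1)
      show "\<exists>K. compact K \<and> (\<forall>\<^sub>F n in sequentially. (\<Sum>i<n. indicator (- K) (W i \<omega>)) / real n < e)"
        by blast
    qed
    have closed: "closedin weak_topology (mfe_set C F lam0)"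
      by (rule closedin_mfe_set[OF basis C_graph_closed C_lower F F_cont lam])
    show ?case
      unfolding upper_vietoris_def limitin_topology_generated_by
    proof (intro conjI ballI impI)
      show "mfe_set C F lam0 \<in> \<Union>{{A. closedin weak_topology A \<and> A \<subseteq> E} |E. openin weak_topology E}"
        using closed closedin_subset[OF closed] openin_topspace by blast
    next
      fix S assume "S \<in> {{A. closedin weak_topology A \<and> A \<subseteq> E} |E. openin weak_topology E}"
        and "mfe_set C F lam0 \<in> S"
      then obtain E where S: "S = {A. closedin weak_topology A \<and> A \<subseteq> E}"
        and E: "openin weak_topology E" "mfe_set C F lam0 \<subseteq> E" by blast
      show "\<forall>\<^sub>F n in sequentially. nash_set C F n (\<lambda>k. W k \<omega>) \<in> S"
        \<comment> \<open>At \<open>n = 0\<close> the only empirical measure is the null measure,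
          which is no probability measure, so \<open>nash_set\<close> is closed in the weak topology
          only for positive \<open>n\<close>.\<close>
        using sub[OF E] eventually_gt_at_top[of 0]
        by eventually_elim (simp add: S closedin_nash_set[OF X_compact C_closed F F_cont])
    qed
  qed
qed

end
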